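(* Let $(M^m,g)$ be a Riemannian manifold of dimension $m\neq 2$, let $\rho\in C^\infty(M)$, put $\overline g=e^{2\rho}g$, and let ${\bf 1}:(M^m,g)\to(M^m,\overline g)$ be the identity map. (a) If $\rho=\ln\sqrt{f}$, where $f$ is a nonconstant affine positive function on $(M,\overline g)$, then ${\bf 1}$ is proper biharmonic. (b) If $\rho$ is a nonconstant affine function on $(M,\overline g)$, then ${\bf 1}$ is proper biharmonic if and only if $m=4$.
   Context: All manifolds, metrics and maps are smooth; manifolds are connected and without boundary. A function on a Riemannian manifold is affine if its restriction to any geodesic is affine with respect to the real parameter or, equivalently, if its gradient is parallel. For a map $\phi:(M,g)\to(N,h)$, the tension field is $\tau(\phi)=\operatorname{trace}_g\nabla d\phi$, a section of $\phi^{-1}TN$; $\phi$ is harmonic if $\tau(\phi)=0$. The bitension field is $\tau_2(\phi)=-\Delta\tau(\phi)-\sum_iR^N(d\phi(e_i),\tau(\phi))d\phi(e_i)$, where $\{e_i\}$ is a local $g$-orthonormal frame, $\Delta=-\operatorname{trace}\nabla^2$ is the rough Laplacian on sections of $\phi^{-1}TN$ and $R^N(X,Y)Z=[\nabla_X,\nabla_Y]Z-\nabla_{[X,Y]}Z$. The map $\phi$ is biharmonic if $\tau_2(\phi)=0$, and proper biharmonic if it is biharmonic and not harmonic. *)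

theory Defs
  imports "HOL-Analysis.Analysis"
begin

section \<open>Smooth functions on open subsets of Euclidean space\<close>

primrec Ck_on :: "nat \<Rightarrow> ('a::euclidean_space \<Rightarrow> 'b::real_normed_vector) \<Rightarrow> 'a set \<Rightarrow> bool" where
  "Ck_on 0 F S \<longleftrightarrow> continuous_on S F"
| "Ck_on (Suc k) F S \<longleftrightarrow>
     (\<forall>u\<in>S. F differentiable (at u)) \<and> (\<forall>X. Ck_on k (\<lambda>u. frechet_derivative F (at u) X) S)"

definition smooth_on :: "('a::euclidean_space \<Rightarrow> 'b::real_normed_vector) \<Rightarrow> 'a set \<Rightarrow> bool" where
  "smooth_on F S \<longleftrightarrow> (\<forall>k. Ck_on k F S)"


section \<open>Manifolds, smooth functions and smooth maps\<close>

text \<open>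
  A chart is a pair of a domain and a coordinate map; the values of the coordinate map outside
  the domain play no role.  A manifold is the whole (Hausdorff, second countable) type \<open>'a\<close>
  together with a smooth atlas \<open>A\<close>, which need not be maximal.
\<close>

type_synonym ('a, 'm) chart = "'a set \<times> ('a \<Rightarrow> real^'m)"

abbreviation chart_dom :: "('a, 'm::finite) chart \<Rightarrow> 'a set" where
  "chart_dom c \<equiv> fst c"

abbreviation chart_map :: "('a, 'm::finite) chart \<Rightarrow> 'a \<Rightarrow> real^'m" where
  "chart_map c \<equiv> snd c"

definition chart_inv :: "('a, 'm::finite) chart \<Rightarrow> real^'m \<Rightarrow> 'a" where
  "chart_inv c = inv_into (chart_dom c) (chart_map c)"

definition chart_image :: "('a, 'm::finite) chart \<Rightarrow> (real^'m) set" where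
  "chart_image c = chart_map c ` chart_dom c"

definition is_chart :: "('a::topological_space, 'm::finite) chart \<Rightarrow> bool" where
  "is_chart c \<longleftrightarrow> open (chart_dom c) \<and> open (chart_image c) \<and>
     homeomorphism (chart_dom c) (chart_image c) (chart_map c) (chart_inv c)"

text \<open>The coordinate expression of a map between manifolds, and the open set on which it is
  meaningful.\<close>

definition coord_expr ::
  "('a, 'm::finite) chart \<Rightarrow> ('b, 'n::finite) chart \<Rightarrow> ('a \<Rightarrow> 'b) \<Rightarrow> real^'m \<Rightarrow> real^'n" where
  "coord_expr c d \<phi> = chart_map d \<circ> \<phi> \<circ> chart_inv c"

definition coord_dom ::
  "('a, 'm::finite) chart \<Rightarrow> ('b, 'n::finite) chart \<Rightarrow> ('a \<Rightarrow> 'b) \<Rightarrow> (real^'m) set" where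
  "coord_dom c d \<phi> = chart_map c ` (chart_dom c \<inter> \<phi> -` chart_dom d)"

definition smooth_manifold ::
  "('a::{t2_space, second_countable_topology}, 'm::finite) chart set \<Rightarrow> bool" where
  "smooth_manifold A \<longleftrightarrow>
     connected (UNIV :: 'a set) \<and>
     (\<forall>c\<in>A. is_chart c) \<and>
     (\<Union>c\<in>A. chart_dom c) = UNIV \<and>
     (\<forall>c\<in>A. \<forall>c'\<in>A. smooth_on (coord_expr c c' id) (coord_dom c c' id))"

definition smooth_fun :: "('a, 'm::finite) chart set \<Rightarrow> ('a \<Rightarrow> real) \<Rightarrow> bool" where
  "smooth_fun A f \<longleftrightarrow> (\<forall>c\<in>A. smooth_on (f \<circ> chart_inv c) (chart_image c))"

definition smooth_map ::
  "('a::topological_space, 'm::finite) chart set \<Rightarrow> ('b::topological_space, 'n::finite) chart set \<Rightarrow>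
   ('a \<Rightarrow> 'b) \<Rightarrow> bool" where
  "smooth_map A B \<phi> \<longleftrightarrow>
     continuous_on UNIV \<phi> \<and>
     (\<forall>c\<in>A. \<forall>d\<in>B. smooth_on (coord_expr c d \<phi>) (coord_dom c d \<phi>))"


section \<open>Riemannian metrics\<close>

text \<open>
  A metric assigns to every chart \<open>c\<close> of the atlas the matrix \<open>g c u\<close> of its components with
  respect to the coordinate frame of \<open>c\<close>, at the point with coordinates \<open>u\<close>.  The last clause is
  the transformation law of a (0,2)-tensor.
\<close>

type_synonym ('a, 'm) metric = "('a, 'm) chart \<Rightarrow> real^'m \<Rightarrow> real^'m^'m"

definition riemannian_metric ::
  "('a, 'm::finite) chart set \<Rightarrow> ('a, 'm) metric \<Rightarrow> bool" where
  "riemannian_metric A g \<longleftrightarrow>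
     (\<forall>c\<in>A. smooth_on (g c) (chart_image c) \<and>
        (\<forall>u\<in>chart_image c. transpose (g c u) = g c u \<and> (\<forall>X. X \<noteq> 0 \<longrightarrow> X \<bullet> (g c u *v X) > 0))) \<and>
     (\<forall>c\<in>A. \<forall>c'\<in>A. \<forall>u\<in>coord_dom c c' id. \<forall>X Y.
        X \<bullet> (g c u *v Y) =
        frechet_derivative (coord_expr c c' id) (at u) X \<bullet>
          (g c' (coord_expr c c' id u) *v frechet_derivative (coord_expr c c' id) (at u) Y))"

definition conformal_metric ::
  "('a \<Rightarrow> real) \<Rightarrow> ('a, 'm::finite) metric \<Rightarrow> ('a, 'm) metric" where
  "conformal_metric \<rho> g = (\<lambda>c u. exp (2 * \<rho> (chart_inv c u)) *\<^sub>R g c u)"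


section \<open>Tension and bitension field in coordinates\<close>

text \<open>
  In this section \<open>G\<close> and \<open>H\<close> are component matrices of metrics on open subsets of \<open>real^'m\<close> and
  \<open>real^'n\<close>, and \<open>F\<close> is (the coordinate expression of) a map between these open sets.
  Vectors \<open>X\<close>, \<open>Y\<close>, \<open>Z\<close> are identified with the vector fields whose coordinate components are
  constant; in particular their Lie brackets vanish.
\<close>

text \<open>\<open>christoffel G u X Y\<close> is the Levi-Civita derivative of \<open>Y\<close> in direction \<open>X\<close>, obtained from
  the Koszul formula; its \<open>k\<close>-th component is
  \<open>\<Gamma>\<^sup>k\<^sub>i\<^sub>j X\<^sup>i Y\<^sup>j\<close>.\<close>

definition christoffel ::
  "(real^'m \<Rightarrow> real^'m^'m) \<Rightarrow> real^'m \<Rightarrow> real^'m \<Rightarrow> real^'m \<Rightarrow> real^'m::finite" where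
  "christoffel G u X Y =
     matrix_inv (G u) *v
       (\<chi> l. (Y \<bullet> (frechet_derivative G (at u) X *v axis l 1)
            + X \<bullet> (frechet_derivative G (at u) Y *v axis l 1)
            - X \<bullet> (frechet_derivative G (at u) (axis l 1) *v Y)) / 2)"

text \<open>The connection of the pull-back bundle along \<open>F\<close>: the derivative in direction \<open>X\<close> of a
  section \<open>V\<close>.  With \<open>F\<close> the identity this is the Levi-Civita connection of \<open>H\<close>.\<close>

definition pullback_cov ::
  "(real^'n \<Rightarrow> real^'n^'n) \<Rightarrow> (real^'m \<Rightarrow> real^'n) \<Rightarrow> (real^'m \<Rightarrow> real^'n) \<Rightarrow>
   real^'m::finite \<Rightarrow> real^'m \<Rightarrow> real^'n::finite" where
  "pullback_cov H F V u X =
     frechet_derivative V (at u) X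
     + christoffel H (F u) (frechet_derivative F (at u) X) (V u)"

definition levi_civita ::
  "(real^'n \<Rightarrow> real^'n^'n) \<Rightarrow> (real^'n \<Rightarrow> real^'n) \<Rightarrow> real^'n \<Rightarrow> real^'n \<Rightarrow> real^'n::finite" where
  "levi_civita H V u X = pullback_cov H (\<lambda>v. v) V u X"

definition metric_trace ::
  "real^'m^'m \<Rightarrow> (real^'m \<Rightarrow> real^'m \<Rightarrow> 'b::real_vector) \<Rightarrow> 'b" where
  "metric_trace P B =
     (\<Sum>i\<in>(UNIV::'m::finite set). \<Sum>j\<in>UNIV. (matrix_inv P $ i $ j) *\<^sub>R B (axis i 1) (axis j 1))"

text \<open>Contraction with the inverse metric is the sum over any orthonormal basis.\<close>

lemma metric_trace_orthonormal:
  fixes P :: "real^'m::finite^'m" and B :: "real^'m \<Rightarrow> real^'m \<Rightarrow> 'b::real_normed_vector"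
    and E :: "'m \<Rightarrow> real^'m"
  assumes B: "bilinear B"
    and E: "\<And>i j. E i \<bullet> (P *v E j) = (if i = j then 1 else 0)"
  shows "metric_trace P B = (\<Sum>i\<in>UNIV. B (E i) (E i))"
proof -
  define Q :: "real^'m^'m" where "Q = (\<chi> r i. E i $ r)"
  have colQ: "Q *v axis j 1 = E j" for j
    by (simp add: matrix_vector_mult_basis column_def Q_def vec_eq_iff)
  have "(transpose Q ** (P ** Q)) = mat 1"
  proof -
    have "(transpose Q ** (P ** Q)) $ i $ j = (mat 1 :: real^'m^'m) $ i $ j" for i j
    proof -
      have "(transpose Q ** (P ** Q)) $ i $ j = axis i 1 \<bullet> ((transpose Q ** (P ** Q)) *v axis j 1)"
        by (simp add: matrix_vector_mult_basis column_def inner_axis')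
      also have "\<dots> = axis i 1 \<bullet> (transpose Q *v (P *v (Q *v axis j 1)))"
        by (simp only: matrix_vector_mul_assoc)
      also have "\<dots> = (Q *v axis i 1) \<bullet> (P *v (Q *v axis j 1))"
        by (metis dot_lmul_matrix vector_transpose_matrix transpose_matrix_vector)
      finally show ?thesis by (simp add: colQ E mat_def)
    qed
    then show ?thesis by (simp add: vec_eq_iff)
  qed
  then have "(transpose Q ** P) ** Q = mat 1" by (simp add: matrix_mul_assoc)
  then have "Q ** (transpose Q ** P) = mat 1" by (simp add: matrix_left_right_inverse)
  then have QP: "(Q ** transpose Q) ** P = mat 1" by (simp add: matrix_mul_assoc)
  then have PQ: "P ** (Q ** transpose Q) = mat 1" by (simp add: matrix_left_right_inverse)
  have "matrix_inv P ** P = mat 1"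
    unfolding matrix_inv_def by (rule someI2[where a = "Q ** transpose Q"]) (use PQ QP in auto)
  then have "matrix_inv P = Q ** transpose Q"
    by (metis PQ matrix_mul_assoc matrix_mul_lid matrix_mul_rid)
  then have inv: "matrix_inv P $ i $ j = (\<Sum>k\<in>UNIV. E k $ i * E k $ j)" for i j
    by (simp add: matrix_matrix_mult_def transpose_def Q_def)
  have exp: "B (E k) (E k) = (\<Sum>i\<in>UNIV. \<Sum>j\<in>UNIV. (E k $ i * E k $ j) *\<^sub>R B (axis i 1) (axis j 1))" for k
  proof -
    have e: "E k = (\<Sum>i\<in>UNIV. E k $ i *\<^sub>R axis i 1)"
      using basis_expansion[of "E k"] by (simp add: scalar_mult_eq_scaleR)
    have "B (E k) (E k) = B (\<Sum>i\<in>UNIV. E k $ i *\<^sub>R axis i 1) (\<Sum>j\<in>UNIV. E k $ j *\<^sub>R axis j 1)"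
      using e by simp
    also have "\<dots> = (\<Sum>(i,j)\<in>UNIV \<times> UNIV. B (E k $ i *\<^sub>R axis i 1) (E k $ j *\<^sub>R axis j 1))"
      by (rule bilinear_sum[OF B])
    finally show ?thesis
      by (simp add: sum.cartesian_product[symmetric] bilinear_lmul[OF B] bilinear_rmul[OF B] mult.commute
               flip: UNIV_Times_UNIV)
  qed
  have "metric_trace P B = (\<Sum>i\<in>UNIV. \<Sum>j\<in>UNIV. \<Sum>k\<in>UNIV. (E k $ i * E k $ j) *\<^sub>R B (axis i 1) (axis j 1))"
    by (simp add: metric_trace_def inv scaleR_sum_left)
  also have "\<dots> = (\<Sum>i\<in>UNIV. \<Sum>k\<in>UNIV. \<Sum>j\<in>UNIV. (E k $ i * E k $ j) *\<^sub>R B (axis i 1) (axis j 1))"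
    by (intro sum.cong refl sum.swap)
  also have "\<dots> = (\<Sum>k\<in>UNIV. \<Sum>i\<in>UNIV. \<Sum>j\<in>UNIV. (E k $ i * E k $ j) *\<^sub>R B (axis i 1) (axis j 1))"
    by (rule sum.swap)
  finally show ?thesis by (simp add: exp)
qed

definition second_fundamental_form ::
  "(real^'m \<Rightarrow> real^'m^'m) \<Rightarrow> (real^'n \<Rightarrow> real^'n^'n) \<Rightarrow> (real^'m \<Rightarrow> real^'n) \<Rightarrow>
   real^'m::finite \<Rightarrow> real^'m \<Rightarrow> real^'m \<Rightarrow> real^'n::finite" where
  "second_fundamental_form G H F u X Y =
     pullback_cov H F (\<lambda>v. frechet_derivative F (at v) Y) u X
     - frechet_derivative F (at u) (levi_civita G (\<lambda>v. Y) u X)"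

definition tension ::
  "(real^'m \<Rightarrow> real^'m^'m) \<Rightarrow> (real^'n \<Rightarrow> real^'n^'n) \<Rightarrow> (real^'m \<Rightarrow> real^'n) \<Rightarrow>
   real^'m::finite \<Rightarrow> real^'n::finite" where
  "tension G H F u = metric_trace (G u) (second_fundamental_form G H F u)"

definition rough_laplacian ::
  "(real^'m \<Rightarrow> real^'m^'m) \<Rightarrow> (real^'n \<Rightarrow> real^'n^'n) \<Rightarrow> (real^'m \<Rightarrow> real^'n) \<Rightarrow>
   (real^'m \<Rightarrow> real^'n) \<Rightarrow> real^'m::finite \<Rightarrow> real^'n::finite" where
  "rough_laplacian G H F V u =
     - metric_trace (G u) (\<lambda>X Y.
         pullback_cov H F (\<lambda>v. pullback_cov H F V v Y) u X
         - pullback_cov H F V u (levi_civita G (\<lambda>v. Y) u X))"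

definition riemann_curvature ::
  "(real^'n \<Rightarrow> real^'n^'n) \<Rightarrow> real^'n \<Rightarrow> real^'n \<Rightarrow> real^'n \<Rightarrow> real^'n \<Rightarrow> real^'n::finite" where
  "riemann_curvature H y X Y Z =
     levi_civita H (\<lambda>v. levi_civita H (\<lambda>w. Z) v Y) y X
     - levi_civita H (\<lambda>v. levi_civita H (\<lambda>w. Z) v X) y Y"

definition bitension ::
  "(real^'m \<Rightarrow> real^'m^'m) \<Rightarrow> (real^'n \<Rightarrow> real^'n^'n) \<Rightarrow> (real^'m \<Rightarrow> real^'n) \<Rightarrow>
   real^'m::finite \<Rightarrow> real^'n::finite" where
  "bitension G H F u =
     - rough_laplacian G H F (tension G H F) u
     - metric_trace (G u) (\<lambda>X Y.
         riemann_curvature H (F u) (frechet_derivative F (at u) X) (tension G H F u)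
           (frechet_derivative F (at u) Y))"


section \<open>Harmonic and biharmonic maps, affine functions\<close>

text \<open>In the following definitions \<open>(A, g)\<close> and \<open>(B, h)\<close> are the atlas and metric of the domain
  and of the target.\<close>

definition harmonic_map ::
  "('a::topological_space, 'm::finite) chart set \<Rightarrow> ('a, 'm) metric \<Rightarrow>
   ('b::topological_space, 'n::finite) chart set \<Rightarrow> ('b, 'n) metric \<Rightarrow> ('a \<Rightarrow> 'b) \<Rightarrow> bool" where
  "harmonic_map A g B h \<phi> \<longleftrightarrow> smooth_map A B \<phi> \<and>
     (\<forall>c\<in>A. \<forall>d\<in>B. \<forall>u\<in>coord_dom c d \<phi>. tension (g c) (h d) (coord_expr c d \<phi>) u = 0)"

definition biharmonic_map ::
  "('a::topological_space, 'm::finite) chart set \<Rightarrow> ('a, 'm) metric \<Rightarrow>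
   ('b::topological_space, 'n::finite) chart set \<Rightarrow> ('b, 'n) metric \<Rightarrow> ('a \<Rightarrow> 'b) \<Rightarrow> bool" where
  "biharmonic_map A g B h \<phi> \<longleftrightarrow> smooth_map A B \<phi> \<and>
     (\<forall>c\<in>A. \<forall>d\<in>B. \<forall>u\<in>coord_dom c d \<phi>. bitension (g c) (h d) (coord_expr c d \<phi>) u = 0)"

definition proper_biharmonic_map ::
  "('a::topological_space, 'm::finite) chart set \<Rightarrow> ('a, 'm) metric \<Rightarrow>
   ('b::topological_space, 'n::finite) chart set \<Rightarrow> ('b, 'n) metric \<Rightarrow> ('a \<Rightarrow> 'b) \<Rightarrow> bool" where
  "proper_biharmonic_map A g B h \<phi> \<longleftrightarrow>
     biharmonic_map A g B h \<phi> \<and> \<not> harmonic_map A g B h \<phi>"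

definition gradient ::
  "(real^'m \<Rightarrow> real^'m^'m) \<Rightarrow> (real^'m \<Rightarrow> real) \<Rightarrow> real^'m \<Rightarrow> real^'m::finite" where
  "gradient G f u = matrix_inv (G u) *v (\<chi> i. frechet_derivative f (at u) (axis i 1))"

text \<open>Affine functions are those with parallel gradient; equivalently, those that are affine in the
  parameter along every geodesic.\<close>

definition affine_fun ::
  "('a, 'm::finite) chart set \<Rightarrow> ('a, 'm) metric \<Rightarrow> ('a \<Rightarrow> real) \<Rightarrow> bool" where
  "affine_fun A g f \<longleftrightarrow> smooth_fun A f \<and>
     (\<forall>c\<in>A. \<forall>u\<in>chart_image c. \<forall>X.
        levi_civita (g c) (gradient (g c) (f \<circ> chart_inv c)) u X = 0)"

end

theory Submission
  imports Defs
begin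

text \<open>
  Write \<open>h = e\<^sup>2\<^sup>\<rho>g\<close> and let \<open>\<xi>\<close> be the \<open>h\<close>-gradient of \<open>\<rho>\<close>.  The Koszul formula gives
  \<open>\<nabla>d\<^bold>1(X, Y) = d\<rho>(X) Y + d\<rho>(Y) X - h(X, Y) \<xi>\<close> and hence the tension field
  \<open>\<tau> = (2 - m) e\<^sup>2\<^sup>\<rho> \<xi>\<close>.  In (a) it is a constant multiple of the gradient of
  \<open>f = e\<^sup>2\<^sup>\<rho>\<close>, in (b) a function times the parallel field \<open>\<xi>\<close>.  If \<open>\<tau> = \<phi> T\<close> with \<open>T\<close> parallel, then
  \<open>R(X, T)Y = 0\<close> and only \<open>(\<Delta>\<^sub>g\<phi>) T\<close> remains of the bitension field, where \<open>\<Delta>\<^sub>g\<close> is the trace of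
  the Hessian.  This is \<open>0\<close> in (a) and \<open>2 (2 - m) (4 - m) e\<^sup>4\<^sup>\<rho> |\<xi>|\<^sup>2 \<xi>\<close> in (b).  Since \<open>m \<noteq> 2\<close>,
  harmonicity would force \<open>d\<rho> = 0\<close>.
\<close>

section \<open>Second derivatives and inverse matrices\<close>

lemma frechet_derivative_eqI:
  "(f has_derivative f') (at x) \<Longrightarrow> frechet_derivative f (at x) = f'"
  by (rule frechet_derivative_at [symmetric])

text \<open>The mean value theorem in direction \<open>X\<close> turns the second difference into
  \<open>t\<close> times an increment of the directional derivative of \<open>f\<close> along
  \<open>X\<close>. Differentiability of that derivative at \<open>u\<close> evaluates the increment
  up to o(t).\<close>

lemma second_difference_estimate:
  fixes f :: "'a::real_normed_vector \<Rightarrow> real"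
  assumes S: "open S" "u \<in> S" and f: "\<And>v. v \<in> S \<Longrightarrow> f differentiable (at v)"
    and fX: "(\<lambda>v. frechet_derivative f (at v) X) differentiable (at u)"
    and e: "e > 0"
  shows "\<forall>\<^sub>F t in at_right 0.
    \<bar>f (u + t *\<^sub>R X + t *\<^sub>R Y) - f (u + t *\<^sub>R X) - f (u + t *\<^sub>R Y) + f u
      - t\<^sup>2 * frechet_derivative (\<lambda>v. frechet_derivative f (at v) X) (at u) Y\<bar> \<le> e * t\<^sup>2"
proof -
  define p where "p = (\<lambda>v. frechet_derivative f (at v) X)"
  define p' where "p' = frechet_derivative p (at u)"
  \<comment> \<open>Two errors, each at most \<open>e / C * (t * (norm X + norm Y))\<close>, must
    add up to at most \<open>e * t\<close>; the summand 1 keeps \<open>C\<close> positive when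
    \<open>X\<close> and \<open>Y\<close> vanish.\<close>
  define C where "C = 2 * (norm X + norm Y) + 1"
  have C: "C > 0" by (simp add: C_def add_nonneg_pos)
  have p': "(p has_derivative p') (at u)"
    using fX by (simp add: p_def p'_def frechet_derivative_works)
  then have lin: "linear p'" by (rule has_derivative_linear)
  have "e / C > 0" using e C by simp
  with p' obtain d where d: "d > 0"
    and dp: "\<And>y. norm (y - u) < d \<Longrightarrow> norm (p y - p u - p' (y - u)) \<le> e / C * norm (y - u)"
    unfolding has_derivative_at_alt by blast
  obtain d' where d': "d' > 0" "ball u d' \<subseteq> S" using S open_contains_ball by blast
  define D where "D = min d d' / C"
  have D: "D > 0" using d d' C by (simp add: D_def)
  have *: "\<bar>f (u + t *\<^sub>R X + t *\<^sub>R Y) - f (u + t *\<^sub>R X) - f (u + t *\<^sub>R Y) + f u - t\<^sup>2 * p' Y\<bar> \<le> e * t\<^sup>2"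
    if t: "0 < t" "t < D" for t
  proof -
    have small: "norm (s *\<^sub>R X + r *\<^sub>R Y) \<le> t * (norm X + norm Y)"
      if "0 \<le> s" "s \<le> t" "0 \<le> r" "r \<le> t" for s r
    proof -
      have "norm (s *\<^sub>R X + r *\<^sub>R Y) \<le> s * norm X + r * norm Y"
        using norm_triangle_ineq[of "s *\<^sub>R X" "r *\<^sub>R Y"] that by simp
      also have "\<dots> \<le> t * norm X + t * norm Y"
        using that by (intro add_mono mult_right_mono) auto
      finally show ?thesis by (simp add: algebra_simps)
    qed
    have tC: "t * (norm X + norm Y) < min d d'"
    proof -
      have "t * (norm X + norm Y) \<le> t * C" using t by (simp add: C_def add_nonneg_nonneg)
      also have "\<dots> < min d d'" using t C by (simp add: D_def field_simps)
      finally show ?thesis .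
    qed
    have inS: "u + s *\<^sub>R X + r *\<^sub>R Y \<in> S" if "0 \<le> s" "s \<le> t" "0 \<le> r" "r \<le> t" for s r
    proof -
      have "norm (s *\<^sub>R X + r *\<^sub>R Y) < d'" using small[OF that] tC by simp
      then have "dist (u + (s *\<^sub>R X + r *\<^sub>R Y)) u < d'" by (simp add: dist_norm)
      then show ?thesis using d' by (auto simp: add.assoc dist_commute)
    qed
    \<comment> \<open>The \<open>Y\<close>-increment is frozen at \<open>t\<close>, so
      \<open>h t - h 0\<close> is the whole second difference and only \<open>s\<close>
      varies.\<close>
    define h where "h = (\<lambda>s. f (u + s *\<^sub>R X + t *\<^sub>R Y) - f (u + s *\<^sub>R X))"
    have der: "((\<lambda>s. f (u + s *\<^sub>R X + r *\<^sub>R Y)) has_real_derivative p (u + s *\<^sub>R X + r *\<^sub>R Y)) (at s)"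
      if "0 \<le> s" "s \<le> t" "0 \<le> r" "r \<le> t" for s r
    proof -
      have 1: "((\<lambda>s. u + s *\<^sub>R X + r *\<^sub>R Y) has_derivative (\<lambda>s. s *\<^sub>R X)) (at s)"
        by (auto intro!: derivative_eq_intros)
      have 2: "(f has_derivative frechet_derivative f (at (u + s *\<^sub>R X + r *\<^sub>R Y))) (at (u + s *\<^sub>R X + r *\<^sub>R Y))"
        using f[OF inS[OF that]] frechet_derivative_works by blast
      have "((\<lambda>s. f (u + s *\<^sub>R X + r *\<^sub>R Y)) has_derivative
          (\<lambda>s'. frechet_derivative f (at (u + s *\<^sub>R X + r *\<^sub>R Y)) (s' *\<^sub>R X))) (at s)"
        using diff_chain_at[OF 1 2] by (simp add: o_def)
      moreover have "frechet_derivative f (at (u + s *\<^sub>R X + r *\<^sub>R Y)) (s' *\<^sub>R X) = p (u + s *\<^sub>R X + r *\<^sub>R Y) * s'" for s'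
        using linear_scale[OF has_derivative_linear[OF 2]] by (simp add: p_def)
      ultimately show ?thesis by (simp add: has_field_derivative_def)
    qed
    have "\<exists>z>0. z < t \<and> h t - h 0 = (t - 0) * (p (u + z *\<^sub>R X + t *\<^sub>R Y) - p (u + z *\<^sub>R X))"
    proof (rule MVT2)
      fix s assume s: "0 \<le> s" "s \<le> t"
      show "(h has_real_derivative p (u + s *\<^sub>R X + t *\<^sub>R Y) - p (u + s *\<^sub>R X)) (at s)"
        unfolding h_def using der[OF s, of t] der[OF s, of 0] t
        by (intro DERIV_diff) auto
    qed (use t in auto)
    then obtain z where z: "0 < z" "z < t"
      and hz: "h t - h 0 = t * (p (u + z *\<^sub>R X + t *\<^sub>R Y) - p (u + z *\<^sub>R X))" by auto
    \<comment> \<open>Needed for \<open>r = t\<close> and \<open>r = 0\<close>: in the difference of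
      the two, \<open>p u\<close> and \<open>p' (z *\<^sub>R X)\<close> cancel and
      \<open>t * p' Y\<close> remains.\<close>
    have b1: "\<bar>p (u + z *\<^sub>R X + r *\<^sub>R Y) - p u - p' (z *\<^sub>R X + r *\<^sub>R Y)\<bar> \<le> e / C * (t * (norm X + norm Y))"
      if "0 \<le> r" "r \<le> t" for r
    proof -
      have n: "norm (z *\<^sub>R X + r *\<^sub>R Y) \<le> t * (norm X + norm Y)" using small z that by simp
      then have "norm (p (u + z *\<^sub>R X + r *\<^sub>R Y) - p u - p' (z *\<^sub>R X + r *\<^sub>R Y)) \<le> e / C * norm (z *\<^sub>R X + r *\<^sub>R Y)"
        using dp[of "u + z *\<^sub>R X + r *\<^sub>R Y"] tC by (simp add: add.assoc)
      also have "\<dots> \<le> e / C * (t * (norm X + norm Y))"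
        using n e C by (intro mult_left_mono) auto
      finally show ?thesis by simp
    qed
    have lp: "p' (z *\<^sub>R X + t *\<^sub>R Y) = p' (z *\<^sub>R X) + t * p' Y"
      using lin by (simp add: linear_add linear_scale)
    have "\<bar>p (u + z *\<^sub>R X + t *\<^sub>R Y) - p (u + z *\<^sub>R X) - t * p' Y\<bar> \<le> 2 * (e / C * (t * (norm X + norm Y)))"
      using b1[of t] b1[of 0] t lp by simp
    also have "\<dots> = e * t * (2 * (norm X + norm Y) / C)" by simp
    also have "\<dots> \<le> e * t * 1"
      using e t C by (intro mult_left_mono) (auto simp: C_def)
    finally have "t * \<bar>p (u + z *\<^sub>R X + t *\<^sub>R Y) - p (u + z *\<^sub>R X) - t * p' Y\<bar> \<le> t * (e * t)"
      using t by (intro mult_left_mono) auto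
    moreover have "f (u + t *\<^sub>R X + t *\<^sub>R Y) - f (u + t *\<^sub>R X) - f (u + t *\<^sub>R Y) + f u - t\<^sup>2 * p' Y
        = t * (p (u + z *\<^sub>R X + t *\<^sub>R Y) - p (u + z *\<^sub>R X) - t * p' Y)"
      using hz by (simp add: h_def algebra_simps power2_eq_square)
    ultimately show ?thesis using t by (simp only: abs_mult) (simp add: power2_eq_square mult_ac)
  qed
  show ?thesis
    unfolding eventually_at_right_field using D * by (auto simp: p_def p'_def)
qed

text \<open>The second difference is symmetric in \<open>X\<close> and \<open>Y\<close>, and after
  division by the square of \<open>t\<close> it tends to either mixed derivative. Taking
  \<open>e\<close> as a third of the supposed gap contradicts the total error
  \<open>2 * e\<close>.\<close>

lemma symmetric_second_derivative_real:
  fixes f :: "'a::real_normed_vector \<Rightarrow> real"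
  assumes S: "open S" "u \<in> S" and f: "\<And>v. v \<in> S \<Longrightarrow> f differentiable (at v)"
    and fX: "\<And>X. (\<lambda>v. frechet_derivative f (at v) X) differentiable (at u)"
  shows "frechet_derivative (\<lambda>v. frechet_derivative f (at v) X) (at u) Y =
         frechet_derivative (\<lambda>v. frechet_derivative f (at v) Y) (at u) X" (is "?a = ?b")
proof (rule ccontr)
  assume "?a \<noteq> ?b"
  define e where "e = \<bar>?a - ?b\<bar> / 3"
  have e: "e > 0" using \<open>?a \<noteq> ?b\<close> by (simp add: e_def)
  have pos: "\<forall>\<^sub>F t in at_right (0::real). t > 0" by (simp add: eventually_at_right_less)
  have *: "\<forall>\<^sub>F t in at_right 0.
    \<bar>f (u + t *\<^sub>R X + t *\<^sub>R Y) - f (u + t *\<^sub>R X) - f (u + t *\<^sub>R Y) + f u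
      - t\<^sup>2 * frechet_derivative (\<lambda>v. frechet_derivative f (at v) X) (at u) Y\<bar> \<le> e * t\<^sup>2" for X Y
    by (rule second_difference_estimate) (use assms e in auto)
  from *[of X Y] *[of Y X] pos have "\<forall>\<^sub>F t in at_right (0::real). False"
  proof eventually_elim
    case (elim t)
    have swap: "u + t *\<^sub>R Y + t *\<^sub>R X = u + t *\<^sub>R X + t *\<^sub>R Y" by simp
    have "\<bar>t\<^sup>2 * ?a - t\<^sup>2 * ?b\<bar> \<le> 2 * (e * t\<^sup>2)"
      using elim(1,2) unfolding swap by linarith
    then have "t\<^sup>2 * \<bar>?a - ?b\<bar> \<le> t\<^sup>2 * (2 * e)"
      by (simp add: abs_mult mult_ac flip: right_diff_distrib)
    then have "\<bar>?a - ?b\<bar> \<le> 2 * e" using elim(3) by (simp add: mult_le_cancel_left_pos)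
    then show False using e by (simp add: e_def)
  qed
  then show False by simp
qed

lemma symmetric_second_derivative:
  fixes f :: "'a::real_normed_vector \<Rightarrow> 'b::euclidean_space"
  assumes S: "open S" "u \<in> S" and f: "\<And>v. v \<in> S \<Longrightarrow> f differentiable (at v)"
    and fX: "\<And>X. (\<lambda>v. frechet_derivative f (at v) X) differentiable (at u)"
  shows "frechet_derivative (\<lambda>v. frechet_derivative f (at v) X) (at u) Y =
         frechet_derivative (\<lambda>v. frechet_derivative f (at v) Y) (at u) X"
proof (rule euclidean_eqI)
  fix b :: 'b
  have inner: "frechet_derivative (\<lambda>v. h v \<bullet> b) (at v) Z = frechet_derivative h (at v) Z \<bullet> b"
    if "h differentiable (at v)" for h :: "'a \<Rightarrow> 'b" and v Z
    using that[unfolded frechet_derivative_works, THEN bounded_linear.has_derivative[OF bounded_linear_inner_left[of b]]]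
    by (simp add: frechet_derivative_eqI)
  define F where "F = (\<lambda>v. f v \<bullet> b)"
  have F: "F differentiable (at v)" if "v \<in> S" for v
    unfolding F_def using f[OF that] by (simp add: differentiable_inner)
  have second: "((\<lambda>v. frechet_derivative F (at v) Z) has_derivative
      (\<lambda>W. frechet_derivative (\<lambda>v. frechet_derivative f (at v) Z) (at u) W \<bullet> b)) (at u)" for Z
    using fX[of Z, unfolded frechet_derivative_works, THEN bounded_linear.has_derivative[OF bounded_linear_inner_left[of b]]] S(1,2)
    by (rule has_derivative_transform_within_open) (simp add: F_def inner f)
  then have "(\<lambda>v. frechet_derivative F (at v) Z) differentiable (at u)" for Z
    by (auto simp: differentiable_def)
  from symmetric_second_derivative_real[OF S F this, of X Y]
  show "frechet_derivative (\<lambda>v. frechet_derivative f (at v) X) (at u) Y \<bullet> b =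
        frechet_derivative (\<lambda>v. frechet_derivative f (at v) Y) (at u) X \<bullet> b"
    by (simp add: frechet_derivative_eqI[OF second])
qed

section \<open>Derivatives of matrix expressions and differentiability of matrix inverses\<close>

lemma bounded_bilinear_matrix_vector_mult:
  "bounded_bilinear ((*v) :: real^'n^'m \<Rightarrow> real^'n \<Rightarrow> real^'m)"
proof -
  have "bilinear ((*v) :: real^'n^'m \<Rightarrow> real^'n \<Rightarrow> real^'m)"
    unfolding bilinear_def
    by (auto intro!: linearI simp: matrix_vector_mult_add_rdistrib matrix_vector_right_distrib
        scaleR_matrix_vector_assoc matrix_vector_mult_scaleR)
  then show ?thesis by (simp add: bilinear_conv_bounded_bilinear)
qed

lemmas has_derivative_matrix_vector_mult =
  bounded_bilinear.FDERIV[OF bounded_bilinear_matrix_vector_mult]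

lemma has_derivative_matrix_form:
  fixes H :: "'a::real_normed_vector \<Rightarrow> real^'n^'m"
  assumes "(H has_derivative H') (at u)" "(V has_derivative V') (at u)" "(W has_derivative W') (at u)"
  shows "((\<lambda>v. V v \<bullet> (H v *v W v)) has_derivative
    (\<lambda>X. V' X \<bullet> (H u *v W u) + V u \<bullet> (H' X *v W u) + V u \<bullet> (H u *v W' X))) (at u)"
  using has_derivative_inner[OF assms(2) has_derivative_matrix_vector_mult[OF assms(1,3)]]
  by (simp add: inner_add_right algebra_simps)

text \<open>A product rule for a family of linear maps known to be differentiable only at each fixed
  argument; expansion over \<open>Basis\<close> makes it a finite sum of products. It serves to
  differentiate the Christoffel term of a parallel field.\<close>

lemma has_derivative_linear_apply:
  fixes \<Phi> :: "'a::real_normed_vector \<Rightarrow> 'b::euclidean_space \<Rightarrow> 'c::real_normed_vector"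
  assumes S: "open S" "u \<in> S" and lin: "\<And>v. v \<in> S \<Longrightarrow> linear (\<Phi> v)"
    and \<Phi>: "\<And>a. (\<lambda>v. \<Phi> v a) differentiable (at u)" and V: "(V has_derivative V') (at u)"
  shows "((\<lambda>v. \<Phi> v (V v)) has_derivative
           (\<lambda>X. frechet_derivative (\<lambda>v. \<Phi> v (V u)) (at u) X + \<Phi> u (V' X))) (at u)"
proof -
  have exp: "\<Phi> v w = (\<Sum>b\<in>Basis. (w \<bullet> b) *\<^sub>R \<Phi> v b)" if "v \<in> S" for v w
    using lin[OF that] by (subst euclidean_representation[symmetric, of w]) (simp add: linear_sum linear_scale)
  have \<Phi>': "((\<lambda>v. \<Phi> v a) has_derivative frechet_derivative (\<lambda>v. \<Phi> v a) (at u)) (at u)" for a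
    using \<Phi> frechet_derivative_works by blast
  \<comment> \<open>Used for \<open>W = V\<close> and also for the constant \<open>V u\<close>; the
    latter identifies the sum over \<open>Basis\<close> with the derivative at a frozen
    argument.\<close>
  have gen: "((\<lambda>v. \<Phi> v (W v)) has_derivative
      (\<lambda>X. (\<Sum>b\<in>Basis. (W u \<bullet> b) *\<^sub>R frechet_derivative (\<lambda>v. \<Phi> v b) (at u) X) + \<Phi> u (W' X))) (at u)"
    if W: "(W has_derivative W') (at u)" for W W'
  proof -
    have "((\<lambda>v. \<Sum>b\<in>Basis. (W v \<bullet> b) *\<^sub>R \<Phi> v b) has_derivative
        (\<lambda>X. \<Sum>b\<in>Basis. (W u \<bullet> b) *\<^sub>R frechet_derivative (\<lambda>v. \<Phi> v b) (at u) X + (W' X \<bullet> b) *\<^sub>R \<Phi> u b)) (at u)"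
      by (intro has_derivative_sum has_derivative_scaleR has_derivative_inner_left W \<Phi>')
    then have "((\<lambda>v. \<Phi> v (W v)) has_derivative
        (\<lambda>X. \<Sum>b\<in>Basis. (W u \<bullet> b) *\<^sub>R frechet_derivative (\<lambda>v. \<Phi> v b) (at u) X + (W' X \<bullet> b) *\<^sub>R \<Phi> u b)) (at u)"
      by (rule has_derivative_transform_within_open[OF _ S]) (simp add: exp)
    then show ?thesis by (simp add: sum.distrib exp[OF S(2), of "W' _"])
  qed
  have "frechet_derivative (\<lambda>v. \<Phi> v (V u)) (at u) X
      = (\<Sum>b\<in>Basis. (V u \<bullet> b) *\<^sub>R frechet_derivative (\<lambda>v. \<Phi> v b) (at u) X)" for X
    using frechet_derivative_eqI[OF gen[OF has_derivative_const[of "V u"]]] linear_0[OF lin[OF S(2)]] by simp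
  then show ?thesis using gen[OF V] by simp
qed

lemma differentiable_vec_iff:
  fixes f :: "'a::real_normed_vector \<Rightarrow> real^'n"
  shows "f differentiable (at u) \<longleftrightarrow> (\<forall>i. (\<lambda>v. f v $ i) differentiable (at u))"
proof
  assume "f differentiable (at u)"
  then have "(\<lambda>v. f v \<bullet> axis i 1) differentiable (at u)" for i by (intro differentiable_inner) auto
  then show "\<forall>i. (\<lambda>v. f v $ i) differentiable (at u)" by (simp add: inner_axis)
next
  assume "\<forall>i. (\<lambda>v. f v $ i) differentiable (at u)"
  then have "(\<lambda>v. \<Sum>i\<in>UNIV. f v $ i *\<^sub>R axis i 1 :: real^'n) differentiable (at u)"
    by (intro differentiable_sum differentiable_scaleR) auto
  then show "f differentiable (at u)"
    using basis_expansion[of "f _"] by (simp add: scalar_mult_eq_scaleR)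
qed

lemma differentiable_det:
  fixes M :: "'a::real_normed_vector \<Rightarrow> real^'n^'n"
  assumes "\<And>i j. (\<lambda>v. M v $ i $ j) differentiable (at u)"
  shows "(\<lambda>v. det (M v)) differentiable (at u)"
proof -
  have "(\<lambda>v. \<Prod>i\<in>I. M v $ i $ p i) differentiable (at u)" for p :: "'n \<Rightarrow> 'n" and I
  proof -
    have "((\<lambda>v. M v $ i $ p i) has_derivative frechet_derivative (\<lambda>v. M v $ i $ p i) (at u)) (at u)" for i
      using assms frechet_derivative_works by blast
    from has_derivative_prod[of I "\<lambda>i v. M v $ i $ p i", OF this] show ?thesis
      unfolding differentiable_def by blast
  qed
  then show ?thesis unfolding det_def by (intro differentiable_sum differentiable_mult) auto
qed

lemma matrix_inv_left_right:
  fixes M :: "real^'n^'n"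
  assumes "invertible M"
  shows "M ** matrix_inv M = mat 1" "matrix_inv M ** M = mat 1"
  using assms someI_ex[of "\<lambda>B. M ** B = mat 1 \<and> B ** M = mat 1"]
  unfolding invertible_def matrix_inv_def by auto

text \<open>By Cramer's rule the components are quotients of determinants, which are polynomials in
  the entries.\<close>

lemma differentiable_matrix_inv_mult:
  fixes M :: "'a::real_normed_vector \<Rightarrow> real^'n^'n" and b :: "'a \<Rightarrow> real^'n"
  assumes S: "open S" "u \<in> S" and inv: "\<And>v. v \<in> S \<Longrightarrow> invertible (M v)"
    and M: "M differentiable (at u)" and b: "b differentiable (at u)"
  shows "(\<lambda>v. matrix_inv (M v) *v b v) differentiable (at u)"
proof -
  define x where "x v = (\<chi> k. det (\<chi> i j. if j = k then b v $ i else M v $ i $ j) / det (M v))" for v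
  have eq: "matrix_inv (M v) *v b v = x v" if "v \<in> S" for v
    unfolding x_def using inv[OF that]
    by (subst cramer[symmetric]) (auto simp: invertible_det_nz matrix_vector_mul_assoc matrix_inv_left_right)
  have bi: "(\<lambda>v. b v $ i) differentiable (at u)" for i using b differentiable_vec_iff by blast
  have Mij: "(\<lambda>v. M v $ i $ j) differentiable (at u)" for i j
  proof -
    have "(\<lambda>v. M v \<bullet> axis i (axis j 1)) differentiable (at u)" using M by (intro differentiable_inner) auto
    then show ?thesis by (simp add: inner_axis)
  qed
  have "det (M u) \<noteq> 0" using inv[OF S(2)] by (simp add: invertible_det_nz)
  moreover have "(\<lambda>v. if j = k then b v $ i else M v $ i $ j) differentiable (at u)" for i j k
    using bi Mij by (cases "j = k") auto
  ultimately have "x differentiable (at u)"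
    unfolding differentiable_vec_iff x_def
    by (auto intro!: differentiable_divide differentiable_det Mij)
  then obtain x' where "(x has_derivative x') (at u)" by (auto simp: differentiable_def)
  then have "((\<lambda>v. matrix_inv (M v) *v b v) has_derivative x') (at u)"
    by (rule has_derivative_transform_within_open[OF _ S]) (simp add: eq)
  then show ?thesis by (auto simp: differentiable_def)
qed

section \<open>Levi-Civita connection and curvature of a metric in coordinates\<close>

text \<open>Swapping the last and the first pair in turn, six times, restores the order of the
  arguments; the three skew swaps leave the sign -1.\<close>

lemma sym_skew_zero:
  fixes B :: "'a \<Rightarrow> 'a \<Rightarrow> 'a \<Rightarrow> real"
  assumes sym: "\<And>x y z. B x y z = B y x z" and skew: "\<And>x y z. B x y z = - B x z y"
  shows "B x y z = 0"
proof -
  have "B x y z = - B x z y" by (rule skew)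
  also have "\<dots> = - B z x y" by (simp only: sym[of x z])
  also have "\<dots> = B z y x" by (simp only: skew[of z x y])
  also have "\<dots> = B y z x" by (rule sym)
  also have "\<dots> = - B y x z" by (rule skew)
  also have "\<dots> = - B x y z" by (simp only: sym[of x y])
  finally show ?thesis by simp
qed

lemma symmetric_matrix_inner:
  fixes P :: "real^'m^'m"
  assumes "transpose P = P"
  shows "X \<bullet> (P *v Y) = Y \<bullet> (P *v X)"
  by (metis assms dot_lmul_matrix inner_commute transpose_matrix_vector)

lemma linear_inner_coordinates:
  fixes L :: "real^'m \<Rightarrow> real"
  assumes "linear L"
  shows "(\<chi> i. L (axis i 1)) \<bullet> Z = L Z"
proof -
  have "L Z = L (\<Sum>i\<in>UNIV. Z $ i *\<^sub>R axis i 1)"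
    using basis_expansion[of Z] by (simp add: scalar_mult_eq_scaleR)
  then show ?thesis by (simp add: linear_sum[OF assms] linear_scale[OF assms] inner_vec_def mult.commute)
qed

lemma levi_civita_const: "levi_civita H (\<lambda>w. Z) v X = christoffel H v X Z"
  by (simp add: levi_civita_def pullback_cov_def)

lemma levi_civita_eq:
  "levi_civita H W v X = frechet_derivative W (at v) X + christoffel H v X (W v)"
  by (simp add: levi_civita_def pullback_cov_def)

section \<open>The Koszul formula and metric compatibility in coordinates\<close>

locale metric_patch =
  fixes V :: "(real^'m::finite) set" and H :: "real^'m \<Rightarrow> real^'m^'m"
  assumes open_V: "open V"
    and sym: "v \<in> V \<Longrightarrow> transpose (H v) = H v"
    and pos: "v \<in> V \<Longrightarrow> X \<noteq> 0 \<Longrightarrow> X \<bullet> (H v *v X) > 0"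
    and diff: "v \<in> V \<Longrightarrow> H differentiable (at v)"
begin

lemma inner_commute: "v \<in> V \<Longrightarrow> X \<bullet> (H v *v Y) = Y \<bullet> (H v *v X)"
  by (rule symmetric_matrix_inner) (rule sym)

text \<open>Below, identities between vectors are proved by pairing both sides with every
  \<open>Z\<close>, which keeps the inverse matrix out of the computations.\<close>

lemma nondegenerate:
  assumes "v \<in> V" "\<And>Z. X \<bullet> (H v *v Z) = Y \<bullet> (H v *v Z)"
  shows "X = Y"
proof (rule ccontr)
  assume "X \<noteq> Y"
  then have "(X - Y) \<bullet> (H v *v (X - Y)) > 0" using pos assms(1) by simp
  then show False using assms(2)[of "X - Y"] by (simp add: inner_diff_left)
qed

lemma invertible: "v \<in> V \<Longrightarrow> invertible (H v)"
  unfolding invertible_left_inverse matrix_left_invertible_ker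
  by (metis inner_zero_right less_irrefl pos)

lemma inner_matrix_inv:
  assumes "v \<in> V"
  shows "(matrix_inv (H v) *v b) \<bullet> (H v *v Z) = b \<bullet> Z"
proof -
  have "(matrix_inv (H v) *v b) \<bullet> (H v *v Z) = Z \<bullet> (H v *v (matrix_inv (H v) *v b))"
    by (rule inner_commute[OF assms])
  then show ?thesis
    using matrix_inv_left_right[OF invertible[OF assms]]
    by (simp add: matrix_vector_mul_assoc Inner_Product.inner_commute)
qed

lemma has_derivative: "v \<in> V \<Longrightarrow> (H has_derivative frechet_derivative H (at v)) (at v)"
  using diff frechet_derivative_works by blast

lemma frechet_derivative_form:
  "v \<in> V \<Longrightarrow> frechet_derivative (\<lambda>v. Y \<bullet> (H v *v Z)) (at v) X = Y \<bullet> (frechet_derivative H (at v) X *v Z)"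
  using frechet_derivative_eqI[OF has_derivative_matrix_form[OF has_derivative has_derivative_const has_derivative_const]]
  by simp

lemma derivative_commute:
  assumes "v \<in> V"
  shows "Y \<bullet> (frechet_derivative H (at v) X *v Z) = Z \<bullet> (frechet_derivative H (at v) X *v Y)"
proof -
  have "(\<lambda>v. Y \<bullet> (H v *v Z)) differentiable (at v)"
    using has_derivative_matrix_form[OF has_derivative[OF assms] has_derivative_const has_derivative_const]
    unfolding differentiable_def by blast
  from frechet_derivative_transform_within_open[OF this open_V assms inner_commute]
  have "frechet_derivative (\<lambda>v. Y \<bullet> (H v *v Z)) (at v) = frechet_derivative (\<lambda>v. Z \<bullet> (H v *v Y)) (at v)" .
  then show ?thesis using frechet_derivative_form[OF assms] by metis
qed

text \<open>Pairing with \<open>H\<close> cancels the inverse matrix in \<open>christoffel\<close>.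
  The coordinate definition gives the formula on basis vectors, and linearity of the right-hand side
  in \<open>Z\<close> extends it.\<close>

lemma koszul:
  assumes "v \<in> V"
  shows "christoffel H v X Y \<bullet> (H v *v Z) =
     (Y \<bullet> (frechet_derivative H (at v) X *v Z)
    + X \<bullet> (frechet_derivative H (at v) Y *v Z)
    - X \<bullet> (frechet_derivative H (at v) Z *v Y)) / 2" (is "_ = ?R Z")
proof -
  have lin: "linear (frechet_derivative H (at v))" using diff[OF assms] by (rule linear_frechet_derivative)
  have "linear ?R"
    by (rule linearI)
       (simp_all add: linear_add[OF lin] linear_scale[OF lin] matrix_vector_right_distrib inner_add_right
        matrix_vector_mult_scaleR matrix_vector_mult_add_rdistrib add_divide_distrib diff_divide_distrib
        scaleR_matrix_vector_assoc[symmetric] algebra_simps)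
  then have "(\<chi> l. ?R (axis l 1)) \<bullet> Z = ?R Z" by (rule linear_inner_coordinates)
  then show ?thesis unfolding christoffel_def inner_matrix_inv[OF assms] .
qed

lemma christoffel_commute:
  assumes "v \<in> V"
  shows "christoffel H v X Y = christoffel H v Y X"
proof (rule nondegenerate[OF assms])
  fix Z
  show "christoffel H v X Y \<bullet> (H v *v Z) = christoffel H v Y X \<bullet> (H v *v Z)"
    unfolding koszul[OF assms] using derivative_commute[OF assms, of X Z Y] by simp
qed

lemma linear_christoffel:
  assumes "v \<in> V"
  shows "linear (christoffel H v X)"
proof (rule linearI)
  have lin: "linear (frechet_derivative H (at v))" using diff[OF assms] by (rule linear_frechet_derivative)
  show "christoffel H v X (Y + Y') = christoffel H v X Y + christoffel H v X Y'" for Y Y'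
    by (rule nondegenerate[OF assms])
       (simp add: inner_add_left koszul[OF assms] linear_add[OF lin] matrix_vector_right_distrib inner_add_right
        matrix_vector_mult_add_rdistrib field_simps)
  show "christoffel H v X (c *\<^sub>R Y) = c *\<^sub>R christoffel H v X Y" for c Y
    by (rule nondegenerate[OF assms])
       (simp add: inner_scaleR_left koszul[OF assms] linear_scale[OF lin]
        matrix_vector_mult_scaleR scaleR_matrix_vector_assoc[symmetric] field_simps)
qed

text \<open>In the sum of the two Koszul expressions the derivatives along \<open>Y\<close> and
  \<open>Z\<close> cancel, and the two along \<open>X\<close> agree by symmetry of the derivative of
  \<open>H\<close>.\<close>

lemma metric_compatible_const:
  assumes "v \<in> V"
  shows "Y \<bullet> (frechet_derivative H (at v) X *v Z) =
    christoffel H v X Y \<bullet> (H v *v Z) + Y \<bullet> (H v *v christoffel H v X Z)"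
  unfolding inner_commute[OF assms, of Y] koszul[OF assms]
  using derivative_commute[OF assms, of X Y Z] derivative_commute[OF assms, of X Z Y]
    derivative_commute[OF assms, of Z X Y] derivative_commute[OF assms, of Y X Z] by (simp add: field_simps)

lemma levi_civita_scaleR:
  assumes "v \<in> V" "W differentiable (at v)"
  shows "levi_civita H (\<lambda>w. c *\<^sub>R W w) v X = c *\<^sub>R levi_civita H W v X"
proof -
  have "((\<lambda>w. c *\<^sub>R W w) has_derivative (\<lambda>X. c *\<^sub>R frechet_derivative W (at v) X)) (at v)"
    using assms(2) by (intro has_derivative_scaleR_right) (simp add: frechet_derivative_works)
  then show ?thesis
    by (simp add: levi_civita_eq frechet_derivative_eqI linear_scale[OF linear_christoffel[OF assms(1)]]
        scaleR_add_right)
qed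

end

text \<open>The chain rule differentiates \<open>H\<close> along the image of \<open>X\<close>, and
  \<open>metric_compatible_const\<close> splits that term into the two Christoffel terms of the
  pull-back connection.\<close>

lemma (in metric_patch) metric_compatible_pullback:
  fixes F :: "real^'n::finite \<Rightarrow> real^'m"
  assumes "F u \<in> V" "F differentiable (at u)" "W differentiable (at u)" "Z differentiable (at u)"
  shows "((\<lambda>v. W v \<bullet> (H (F v) *v Z v)) has_derivative
    (\<lambda>X. pullback_cov H F W u X \<bullet> (H (F u) *v Z u) + W u \<bullet> (H (F u) *v pullback_cov H F Z u X))) (at u)"
proof -
  have F: "(F has_derivative frechet_derivative F (at u)) (at u)"
    using assms(2) by (simp add: frechet_derivative_works)
  have 1: "((\<lambda>v. H (F v)) has_derivative (\<lambda>X. frechet_derivative H (at (F u)) (frechet_derivative F (at u) X))) (at u)"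
    using diff_chain_at[OF F has_derivative[OF assms(1)]] by (simp add: o_def)
  have 2: "(W has_derivative frechet_derivative W (at u)) (at u)" "(Z has_derivative frechet_derivative Z (at u)) (at u)"
    using assms(3,4) by (simp_all add: frechet_derivative_works)
  show ?thesis
    using has_derivative_matrix_form[OF 1 2]
    by (simp add: metric_compatible_const[OF assms(1)] pullback_cov_def inner_add_left inner_add_right
        matrix_vector_right_distrib add_ac)
qed

lemma (in metric_patch) differentiable_christoffel:
  assumes v: "v \<in> V" and C2: "\<And>X. (\<lambda>v. frechet_derivative H (at v) X) differentiable (at v)"
  shows "(\<lambda>v. christoffel H v X Y) differentiable (at v)"
proof -
  have *: "(\<lambda>v. A \<bullet> (frechet_derivative H (at v) B *v C)) differentiable (at v)" for A B C
    using has_derivative_matrix_form[OF C2[of B, unfolded frechet_derivative_works] has_derivative_const has_derivative_const]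
    unfolding differentiable_def by blast
  show ?thesis
    unfolding christoffel_def
    by (rule differentiable_matrix_inv_mult[OF open_V v invertible diff[OF v]])
       (auto simp: differentiable_vec_iff intro!: differentiable_divide differentiable_add differentiable_diff *)
qed

section \<open>Curvature and its symmetries\<close>

locale metric_patch_C2 = metric_patch +
  assumes diff2: "v \<in> V \<Longrightarrow> (\<lambda>v. frechet_derivative H (at v) X) differentiable (at v)"
begin

lemma riemann_curvature_eq:
  "riemann_curvature H v X Y Z =
    frechet_derivative (\<lambda>v. christoffel H v Y Z) (at v) X + christoffel H v X (christoffel H v Y Z)
  - (frechet_derivative (\<lambda>v. christoffel H v X Z) (at v) Y + christoffel H v Y (christoffel H v X Z))"
  by (simp add: riemann_curvature_def levi_civita_const) (simp add: levi_civita_eq)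

text \<open>The connection is torsion-free: \<open>christoffel\<close> and its derivatives are
  symmetric in their vector arguments, so all terms of the cyclic sum cancel in pairs.\<close>

lemma first_bianchi:
  assumes v: "v \<in> V"
  shows "riemann_curvature H v X Y Z + riemann_curvature H v Y Z X + riemann_curvature H v Z X Y = 0"
proof -
  have D: "frechet_derivative (\<lambda>v. christoffel H v X Y) (at v) = frechet_derivative (\<lambda>v. christoffel H v Y X) (at v)" for X Y
    by (rule frechet_derivative_transform_within_open[OF _ open_V v])
       (use differentiable_christoffel[OF v] diff2[OF v] christoffel_commute in auto)
  show ?thesis
    unfolding riemann_curvature_eq
    using D[of X Y] D[of X Z] D[of Y Z]
      christoffel_commute[OF v, of X Y] christoffel_commute[OF v, of X Z] christoffel_commute[OF v, of Y Z]
    by simp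
qed

text \<open>The inner product of the constant fields \<open>Z\<close> and \<open>W\<close> has
  symmetric second derivatives. Expanding them by metric compatibility and antisymmetrizing in
  \<open>X\<close> and \<open>Y\<close> cancels the mixed terms and leaves the two curvature
  terms.\<close>

lemma curvature_skew:
  assumes v: "v \<in> V"
  shows "riemann_curvature H v X Y Z \<bullet> (H v *v W) = - (riemann_curvature H v X Y W \<bullet> (H v *v Z))"
proof -
  define f where "f = (\<lambda>v. Z \<bullet> (H v *v W))"
  have f: "(f has_derivative (\<lambda>X. Z \<bullet> (frechet_derivative H (at v) X *v W))) (at v)" if "v \<in> V" for v
    unfolding f_def
    using has_derivative_matrix_form[OF has_derivative[OF that] has_derivative_const has_derivative_const] by simp
  have Df: "frechet_derivative f (at v) X = christoffel H v X Z \<bullet> (H v *v W) + Z \<bullet> (H v *v christoffel H v X W)"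
    if "v \<in> V" for v X
    using frechet_derivative_eqI[OF f[OF that]] metric_compatible_const[OF that] by simp
  have id: "(\<lambda>v. v) differentiable (at v)" for v :: "real^'b" by simp
  have ch: "(\<lambda>v. christoffel H v X Y) differentiable (at v)" for X Y
    using differentiable_christoffel[OF v] diff2[OF v] by blast
  have D2: "((\<lambda>v. frechet_derivative f (at v) Y) has_derivative
      (\<lambda>X. levi_civita H (\<lambda>v. christoffel H v Y Z) v X \<bullet> (H v *v W)
         + christoffel H v Y Z \<bullet> (H v *v christoffel H v X W)
         + (christoffel H v X Z \<bullet> (H v *v christoffel H v Y W)
         + Z \<bullet> (H v *v levi_civita H (\<lambda>v. christoffel H v Y W) v X)))) (at v)" for Y
    using has_derivative_add[OF
        metric_compatible_pullback[OF v id ch differentiable_const, of Y Z W, folded levi_civita_def, unfolded levi_civita_const]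
        metric_compatible_pullback[OF v id differentiable_const ch, of Z Y W, folded levi_civita_def, unfolded levi_civita_const]]
    by (rule has_derivative_transform_within_open[OF _ open_V v]) (simp add: Df)
  have "frechet_derivative (\<lambda>v. frechet_derivative f (at v) Y) (at v) X =
        frechet_derivative (\<lambda>v. frechet_derivative f (at v) X) (at v) Y"
    using f D2 by (intro symmetric_second_derivative_real[OF open_V v]) (auto simp: differentiable_def)
  then have "riemann_curvature H v X Y Z \<bullet> (H v *v W) + Z \<bullet> (H v *v riemann_curvature H v X Y W) = 0"
    unfolding frechet_derivative_eqI[OF D2] riemann_curvature_def levi_civita_const
    by (simp add: inner_diff_left inner_diff_right matrix_vector_mult_diff_distrib)
  then show ?thesis using inner_commute[OF v, of Z] by simp
qed

text \<open>For parallel \<open>T\<close>, \<open>(X, Z, W) \<mapsto> \<langle>R(X, T)Z, W\<rangle>\<close> is symmetric in \<open>X, Z\<close> by the Bianchi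
  identity and \<open>R(X, Z)T = 0\<close>, and skew in \<open>Z, W\<close>.\<close>

lemma curvature_parallel:
  assumes T: "\<And>v. v \<in> V \<Longrightarrow> T differentiable (at v)" "\<And>v X. v \<in> V \<Longrightarrow> levi_civita H T v X = 0"
    and v: "v \<in> V"
  shows "riemann_curvature H v X (T v) Z = 0"
proof -
  have DT: "frechet_derivative T (at v) X = - christoffel H v X (T v)" if "v \<in> V" for v X
    using T(2)[OF that, of X] by (simp add: levi_civita_eq eq_neg_iff_add_eq_0)
  have T': "(T has_derivative frechet_derivative T (at v)) (at v)"
    using T(1)[OF v] by (simp add: frechet_derivative_works)
  have ch: "(\<lambda>v. christoffel H v X Y) differentiable (at v)" for X Y
    using differentiable_christoffel[OF v] diff2[OF v] by blast
  have D2: "((\<lambda>v. frechet_derivative T (at v) Y) has_derivative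
      (\<lambda>X. - (frechet_derivative (\<lambda>w. christoffel H w Y (T v)) (at v) X
            + christoffel H v Y (frechet_derivative T (at v) X)))) (at v)" for Y
    by (rule has_derivative_transform_within_open[OF
          has_derivative_minus[OF has_derivative_linear_apply[OF open_V v linear_christoffel ch T', of Y]] open_V v])
       (simp_all add: DT)
  have "frechet_derivative (\<lambda>v. frechet_derivative T (at v) Y) (at v) X =
        frechet_derivative (\<lambda>v. frechet_derivative T (at v) X) (at v) Y" for X Y
    using T(1) D2 by (intro symmetric_second_derivative[OF open_V v]) (auto simp: differentiable_def)
  \<comment> \<open>The equation \<open>DT\<close> for a parallel field determines its second
    derivatives; their symmetry is exactly the vanishing of the curvature on
    \<open>T\<close>.\<close>
  then have flat: "riemann_curvature H v X Y (T v) = 0" for X Y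
    unfolding frechet_derivative_eqI[OF D2] riemann_curvature_eq
    by (simp add: DT[OF v] linear_neg[OF linear_christoffel[OF v]] algebra_simps)
  have anti: "riemann_curvature H v X Y Z = - riemann_curvature H v Y X Z" for X Y Z
    by (simp add: riemann_curvature_def)
  have "riemann_curvature H v X (T v) Z \<bullet> (H v *v W) = 0" for X Z W
  proof (rule sym_skew_zero[of "\<lambda>X Z W. riemann_curvature H v X (T v) Z \<bullet> (H v *v W)"])
    fix X Z W
    have "riemann_curvature H v X (T v) Z = riemann_curvature H v Z (T v) X"
      using first_bianchi[OF v, of X "T v" Z] flat[of Z X] anti[of "T v" Z X]
      by (simp add: eq_neg_iff_add_eq_0 algebra_simps)
    then show "riemann_curvature H v X (T v) Z \<bullet> (H v *v W) = riemann_curvature H v Z (T v) X \<bullet> (H v *v W)"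
      by simp
    show "riemann_curvature H v X (T v) Z \<bullet> (H v *v W) = - (riemann_curvature H v X (T v) W \<bullet> (H v *v Z))"
      by (rule curvature_skew[OF v])
  qed
  then show ?thesis by (intro nondegenerate[OF v]) simp
qed

end

section \<open>Conformal changes seen through a change of coordinates\<close>

lemma metric_trace_add:
  "metric_trace P (\<lambda>X Y. B X Y + C X Y) = metric_trace P B + metric_trace P C"
  by (simp add: metric_trace_def scaleR_add_right sum.distrib)

lemma metric_trace_diff:
  "metric_trace P (\<lambda>X Y. B X Y - C X Y) = metric_trace P B - metric_trace P C"
  by (simp add: metric_trace_def scaleR_diff_right sum_subtractf)

lemma metric_trace_zero: "metric_trace P (\<lambda>X Y. 0) = 0"
  by (simp add: metric_trace_def)

lemma metric_trace_linear:
  assumes "linear L"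
  shows "metric_trace P (\<lambda>X Y. L (B X Y)) = L (metric_trace P B)"
  by (simp add: metric_trace_def linear_sum[OF assms] linear_scale[OF assms])

lemma metric_trace_scaleR_left:
  "metric_trace P (\<lambda>X Y. B X Y *\<^sub>R w) = metric_trace P B *\<^sub>R w"
  by (simp add: metric_trace_def scaleR_sum_left)

lemma metric_trace_mult_left:
  fixes c :: real
  shows "metric_trace P (\<lambda>X Y. c * B X Y) = c * metric_trace P B"
  by (simp add: metric_trace_def sum_distrib_left mult_ac)

lemma matrix_inv_symmetric:
  fixes P :: "real^'m^'m"
  assumes "transpose P = P" "invertible P"
  shows "matrix_inv P $ i $ j = matrix_inv P $ j $ i"
proof -
  note inv = matrix_inv_left_right[OF assms(2)]
  have "transpose (matrix_inv P) ** P = mat 1"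
    by (metis assms(1) inv(1) matrix_transpose_mul transpose_mat)
  then have t: "transpose (matrix_inv P) = matrix_inv P"
    by (metis inv(1) matrix_mul_assoc matrix_mul_lid matrix_mul_rid)
  have "matrix_inv P $ i $ j = transpose (matrix_inv P) $ i $ j" by (simp only: t)
  then show ?thesis by (simp add: transpose_def)
qed

text \<open>Contraction raises the index of \<open>a\<close>, so \<open>b\<close> is evaluated at
  the metric dual of \<open>a\<close>. Symmetry of the inverse matrix makes the order of
  \<open>X\<close> and \<open>Y\<close> immaterial.\<close>

lemma metric_trace_rank_one:
  fixes P :: "real^'m::finite^'m"
  assumes P: "transpose P = P" "invertible P" and b: "linear b"
  shows "metric_trace P (\<lambda>X Y. a X *\<^sub>R b Y) = b (matrix_inv P *v (\<chi> i. a (axis i 1)))"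
    and "metric_trace P (\<lambda>X Y. a Y *\<^sub>R b X) = b (matrix_inv P *v (\<chi> i. a (axis i 1)))"
proof -
  let ?w = "matrix_inv P *v (\<chi> i. a (axis i 1))"
  have "b ?w = b (\<Sum>j\<in>UNIV. ?w $ j *\<^sub>R axis j 1)"
    using basis_expansion[of ?w] by (simp add: scalar_mult_eq_scaleR)
  also have "\<dots> = (\<Sum>j\<in>UNIV. \<Sum>i\<in>UNIV. (matrix_inv P $ j $ i * a (axis i 1)) *\<^sub>R b (axis j 1))"
    by (simp add: linear_sum[OF b] linear_scale[OF b] matrix_vector_mult_def scaleR_sum_left)
  finally have w: "b ?w = (\<Sum>j\<in>UNIV. \<Sum>i\<in>UNIV. (matrix_inv P $ j $ i * a (axis i 1)) *\<^sub>R b (axis j 1))" .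
  show "metric_trace P (\<lambda>X Y. a Y *\<^sub>R b X) = b ?w"
    unfolding w metric_trace_def by simp
  show "metric_trace P (\<lambda>X Y. a X *\<^sub>R b Y) = b ?w"
    unfolding w metric_trace_def by (subst sum.swap) (simp add: matrix_inv_symmetric[OF P])
qed

text \<open>This is the trace of the identity matrix, and the source of the dimension in the tension
  field.\<close>

lemma metric_trace_self:
  fixes P :: "real^'m::finite^'m"
  assumes "transpose P = P" "invertible P"
  shows "metric_trace P (\<lambda>X Y. X \<bullet> (P *v Y)) = CARD('m)"
proof -
  have "X \<bullet> (P *v axis j 1) = axis j 1 \<bullet> (P *v X)" for X j
    by (rule symmetric_matrix_inner[OF assms(1)])
  then have "metric_trace P (\<lambda>X Y. X \<bullet> (P *v Y)) = (\<Sum>i\<in>UNIV. \<Sum>j\<in>UNIV. matrix_inv P $ i $ j * P $ j $ i)"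
    by (simp add: metric_trace_def matrix_vector_mult_basis column_def inner_axis')
  also have "\<dots> = (\<Sum>i\<in>UNIV. (matrix_inv P ** P) $ i $ i)"
    by (simp add: matrix_matrix_mult_def)
  also have "\<dots> = CARD('m)"
    by (simp add: matrix_inv_left_right[OF assms(2)] mat_def)
  finally show ?thesis .
qed

lemma pullback_cov_cong:
  assumes "open S" "u \<in> S" "W differentiable (at u)" "\<And>v. v \<in> S \<Longrightarrow> V v = W v"
  shows "pullback_cov H F V u X = pullback_cov H F W u X"
  unfolding pullback_cov_def
  using frechet_derivative_transform_within_open[OF assms(3,1,2), of V] assms(2,4) by simp

text \<open>The identity map read in a chart of the source and a chart of the target: \<open>F\<close> is the transition
  map, \<open>G\<close> and \<open>H\<close> are the components of \<open>g\<close> and \<open>e\<^sup>2\<^sup>\<rho>g\<close>, and \<open>r\<close> is \<open>\<rho>\<close> in the source chart.  Along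
  \<open>F\<close>, \<open>\<xi>\<close> is the \<open>H\<close>-gradient of \<open>\<rho>\<close>.\<close>

locale conformal_patch = dom: metric_patch U G + cod: metric_patch_C2 V H
  for U G and V :: "(real^'m::finite) set" and H +
  fixes F :: "real^'m \<Rightarrow> real^'m" and r :: "real^'m \<Rightarrow> real" and \<xi> :: "real^'m \<Rightarrow> real^'m"
  assumes F_in: "u \<in> U \<Longrightarrow> F u \<in> V"
    and F_diff: "u \<in> U \<Longrightarrow> F differentiable (at u)"
    and F_diff2: "u \<in> U \<Longrightarrow> (\<lambda>v. frechet_derivative F (at v) X) differentiable (at u)"
    and r_diff: "u \<in> U \<Longrightarrow> r differentiable (at u)"
    and conformal: "u \<in> U \<Longrightarrow> exp (2 * r u) * (X \<bullet> (G u *v Y)) =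
      frechet_derivative F (at u) X \<bullet> (H (F u) *v frechet_derivative F (at u) Y)"
    and xi: "u \<in> U \<Longrightarrow> \<xi> (F u) \<bullet> (H (F u) *v frechet_derivative F (at u) Z) = frechet_derivative r (at u) Z"
begin

abbreviation "DF \<equiv> \<lambda>u. frechet_derivative F (at u)"
abbreviation "dr \<equiv> \<lambda>u. frechet_derivative r (at u)"

lemma linear_DF: "u \<in> U \<Longrightarrow> linear (DF u)"
  using F_diff by (rule linear_frechet_derivative)

lemma linear_dr: "u \<in> U \<Longrightarrow> linear (dr u)"
  using r_diff by (rule linear_frechet_derivative)

text \<open>Conformality makes \<open>DF u\<close> injective, hence surjective between spaces of
  equal dimension, so the vectors \<open>DF u Z\<close> are enough to test with.\<close>

lemma nondegenerate_DF:
  assumes u: "u \<in> U" and eq: "\<And>Z. A \<bullet> (H (F u) *v DF u Z) = B \<bullet> (H (F u) *v DF u Z)"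
  shows "A = B"
proof -
  have "inj (DF u)"
  proof (subst linear_injective_0[OF linear_DF[OF u]], intro allI impI)
    fix X assume "DF u X = 0"
    then have "X \<bullet> (G u *v X) = 0" using conformal[OF u, of X X] by simp
    then show "X = 0" using dom.pos[OF u, of X] by auto
  qed
  then have "surj (DF u)" by (rule linear_inj_imp_surj[OF linear_DF[OF u]])
  then show ?thesis
    using eq by (intro cod.nondegenerate[OF F_in[OF u]]) (metis surjD)
qed

text \<open>On images under \<open>DF\<close>, pairing with \<open>H\<close> is
  \<open>exp (2 * r u)\<close> times pairing with \<open>G\<close>; this factor relates the
  gradients of the two metrics.\<close>

lemma DF_gradient:
  assumes u: "u \<in> U"
  shows "DF u (matrix_inv (G u) *v (\<chi> i. dr u (axis i 1))) = exp (2 * r u) *\<^sub>R \<xi> (F u)"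
proof (rule nondegenerate_DF[OF u])
  fix Z
  show "DF u (matrix_inv (G u) *v (\<chi> i. dr u (axis i 1))) \<bullet> (H (F u) *v DF u Z)
      = exp (2 * r u) *\<^sub>R \<xi> (F u) \<bullet> (H (F u) *v DF u Z)"
    by (simp add: conformal[OF u, symmetric] dom.inner_matrix_inv[OF u]
        linear_inner_coordinates[OF linear_dr[OF u]] xi[OF u])
qed

lemma second_fundamental_form_eq:
  "second_fundamental_form G H F u X Y =
     pullback_cov H F (\<lambda>v. DF v Y) u X - DF u (christoffel G u X Y)"
  by (simp add: second_fundamental_form_def levi_civita_const)

text \<open>The Koszul argument is repeated for the covariant derivative \<open>N\<close> of
  \<open>DF\<close>: differentiate the conformality relation, combine three permutations of the
  result, and subtract the Koszul formula of \<open>G\<close>.\<close>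

lemma conformal_second_fundamental_form:
  assumes u: "u \<in> U"
  shows "second_fundamental_form G H F u X Y =
    dr u X *\<^sub>R DF u Y + dr u Y *\<^sub>R DF u X - (exp (2 * r u) * (X \<bullet> (G u *v Y))) *\<^sub>R \<xi> (F u)"
proof (rule nondegenerate_DF[OF u])
  fix Z
  define N where "N X Y = pullback_cov H F (\<lambda>v. DF v Y) u X" for X Y
  \<comment> \<open>Symmetry of the second derivative of \<open>F\<close> together with
    torsion-freeness of \<open>H\<close>.\<close>
  have N_sym: "N X Y = N Y X" for X Y
    unfolding N_def pullback_cov_def
    using symmetric_second_derivative[OF dom.open_V u F_diff F_diff2[OF u], of Y X]
      cod.christoffel_commute[OF F_in[OF u]] by simp
  have r': "((\<lambda>v. exp (2 * r v)) has_derivative (\<lambda>X. exp (2 * r u) * (2 * dr u X))) (at u)"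
    using r_diff[OF u, unfolded frechet_derivative_works] by (auto intro!: derivative_eq_intros)
  \<comment> \<open>Both sides of \<open>conformal\<close>, applied to \<open>Y\<close> and
    \<open>Z\<close>, are differentiated along \<open>X\<close>.\<close>
  have K: "2 * dr u X * (exp (2 * r u) * (Y \<bullet> (G u *v Z)))
        + exp (2 * r u) * (Y \<bullet> (frechet_derivative G (at u) X *v Z))
      = N X Y \<bullet> (H (F u) *v DF u Z) + DF u Y \<bullet> (H (F u) *v N X Z)" for X Y Z
  proof -
    have 1: "((\<lambda>v. exp (2 * r v) * (Y \<bullet> (G v *v Z))) has_derivative
        (\<lambda>X. exp (2 * r u) * (Y \<bullet> (frechet_derivative G (at u) X *v Z))
           + exp (2 * r u) * (2 * dr u X) * (Y \<bullet> (G u *v Z)))) (at u)"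
      using has_derivative_mult[OF r' has_derivative_matrix_form[OF dom.has_derivative[OF u]
            has_derivative_const has_derivative_const], of Y Z] by simp
    have 2: "((\<lambda>v. DF v Y \<bullet> (H (F v) *v DF v Z)) has_derivative
        (\<lambda>X. N X Y \<bullet> (H (F u) *v DF u Z) + DF u Y \<bullet> (H (F u) *v N X Z))) (at u)"
      unfolding N_def
      by (rule cod.metric_compatible_pullback[OF F_in[OF u] F_diff[OF u] F_diff2[OF u] F_diff2[OF u]])
    have "((\<lambda>v. DF v Y \<bullet> (H (F v) *v DF v Z)) has_derivative
        (\<lambda>X. exp (2 * r u) * (Y \<bullet> (frechet_derivative G (at u) X *v Z))
           + exp (2 * r u) * (2 * dr u X) * (Y \<bullet> (G u *v Z)))) (at u)"
      using 1 dom.open_V u by (rule has_derivative_transform_within_open) (rule conformal)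
    from has_derivative_unique[OF this 2] show ?thesis
      by (simp add: fun_eq_iff algebra_simps)
  qed
  have "2 * (N X Y \<bullet> (H (F u) *v DF u Z)) =
      (N X Y \<bullet> (H (F u) *v DF u Z) + DF u Y \<bullet> (H (F u) *v N X Z))
    + (N Y X \<bullet> (H (F u) *v DF u Z) + DF u X \<bullet> (H (F u) *v N Y Z))
    - (N Z X \<bullet> (H (F u) *v DF u Y) + DF u X \<bullet> (H (F u) *v N Z Y))"
    using N_sym[of X Y] N_sym[of X Z] N_sym[of Y Z]
      cod.inner_commute[OF F_in[OF u], of "DF u Y" "N X Z"] by simp
  also have "\<dots> = 2 * (dr u X * (exp (2 * r u) * (Y \<bullet> (G u *v Z))) + dr u Y * (exp (2 * r u) * (X \<bullet> (G u *v Z)))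
      - dr u Z * (exp (2 * r u) * (X \<bullet> (G u *v Y))))
      + exp (2 * r u) * (Y \<bullet> (frechet_derivative G (at u) X *v Z)
        + X \<bullet> (frechet_derivative G (at u) Y *v Z) - X \<bullet> (frechet_derivative G (at u) Z *v Y))"
    unfolding K[symmetric] by (simp add: algebra_simps)
  also have "\<dots> = 2 * (dr u X * (exp (2 * r u) * (Y \<bullet> (G u *v Z))) + dr u Y * (exp (2 * r u) * (X \<bullet> (G u *v Z)))
      - dr u Z * (exp (2 * r u) * (X \<bullet> (G u *v Y))))
      + 2 * (exp (2 * r u) * (christoffel G u X Y \<bullet> (G u *v Z)))"
    unfolding dom.koszul[OF u] by simp
  finally have "N X Y \<bullet> (H (F u) *v DF u Z) =
      dr u X * (exp (2 * r u) * (Y \<bullet> (G u *v Z))) + dr u Y * (exp (2 * r u) * (X \<bullet> (G u *v Z)))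
      - dr u Z * (exp (2 * r u) * (X \<bullet> (G u *v Y)))
      + exp (2 * r u) * (christoffel G u X Y \<bullet> (G u *v Z))" by simp
  then show "second_fundamental_form G H F u X Y \<bullet> (H (F u) *v DF u Z) =
      (dr u X *\<^sub>R DF u Y + dr u Y *\<^sub>R DF u X - (exp (2 * r u) * (X \<bullet> (G u *v Y))) *\<^sub>R \<xi> (F u)) \<bullet> (H (F u) *v DF u Z)"
    by (simp add: second_fundamental_form_eq N_def inner_add_left inner_diff_left conformal[OF u, symmetric] xi[OF u])
qed

text \<open>The two rank-one terms of the second fundamental form each contribute
  \<open>exp (2 * r u)\<close> times \<xi>, and the metric term removes that vector
  \<open>CARD('m)\<close> times.\<close>

lemma tension_conformal:
  assumes u: "u \<in> U"
  shows "tension G H F u = ((2 - real CARD('m)) * exp (2 * r u)) *\<^sub>R \<xi> (F u)"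
proof -
  note P = dom.sym[OF u] dom.invertible[OF u]
  have eq: "second_fundamental_form G H F u = (\<lambda>X Y.
    dr u X *\<^sub>R DF u Y + dr u Y *\<^sub>R DF u X - (exp (2 * r u) * (X \<bullet> (G u *v Y))) *\<^sub>R \<xi> (F u))"
    by (intro ext) (rule conformal_second_fundamental_form[OF u])
  show ?thesis
    unfolding tension_def eq metric_trace_diff metric_trace_add metric_trace_scaleR_left
      metric_trace_mult_left metric_trace_self[OF P] metric_trace_rank_one[OF P linear_DF[OF u]] DF_gradient[OF u]
    by (simp add: algebra_simps flip: scaleR_add_left scaleR_diff_left)
qed

text \<open>A parallel field stays parallel when restricted along \<open>F\<close>, so by the
  Leibniz rule only the coefficient is differentiated.\<close>

lemma pullback_cov_parallel:
  assumes u: "u \<in> U" and \<psi>: "\<psi> differentiable (at u)"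
    and P: "P differentiable (at (F u))" "\<And>X. levi_civita H P (F u) X = 0"
  shows "(\<lambda>v. \<psi> v *\<^sub>R P (F v)) differentiable (at u)"
    and "pullback_cov H F (\<lambda>v. \<psi> v *\<^sub>R P (F v)) u X = frechet_derivative \<psi> (at u) X *\<^sub>R P (F u)"
proof -
  have PF: "((\<lambda>v. P (F v)) has_derivative (\<lambda>X. frechet_derivative P (at (F u)) (DF u X))) (at u)"
    using diff_chain_at[OF F_diff[OF u, unfolded frechet_derivative_works] P(1)[unfolded frechet_derivative_works]]
    by (simp add: o_def)
  have *: "((\<lambda>v. \<psi> v *\<^sub>R P (F v)) has_derivative
      (\<lambda>X. \<psi> u *\<^sub>R frechet_derivative P (at (F u)) (DF u X) + frechet_derivative \<psi> (at u) X *\<^sub>R P (F u))) (at u)"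
    by (intro has_derivative_scaleR PF \<psi>[unfolded frechet_derivative_works])
  then show "(\<lambda>v. \<psi> v *\<^sub>R P (F v)) differentiable (at u)" unfolding differentiable_def by blast
  have "frechet_derivative P (at (F u)) (DF u X) + christoffel H (F u) (DF u X) (P (F u)) = 0"
    using P(2) by (simp add: levi_civita_eq)
  then have "\<psi> u *\<^sub>R frechet_derivative P (at (F u)) (DF u X) + \<psi> u *\<^sub>R christoffel H (F u) (DF u X) (P (F u)) = 0"
    by (simp flip: scaleR_add_right)
  then show "pullback_cov H F (\<lambda>v. \<psi> v *\<^sub>R P (F v)) u X = frechet_derivative \<psi> (at u) X *\<^sub>R P (F u)"
    by (simp add: pullback_cov_def frechet_derivative_eqI[OF *] linear_scale[OF cod.linear_christoffel[OF F_in[OF u]]]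
        algebra_simps)
qed

text \<open>Two applications of \<open>pullback_cov_parallel\<close> reduce the Laplacian term to
  the trace of the \<open>G\<close>-Hessian of the coefficient; the curvature term vanishes by
  \<open>curvature_parallel\<close>.\<close>

lemma bitension_parallel:
  assumes P: "\<And>v. v \<in> V \<Longrightarrow> P differentiable (at v)" "\<And>v X. v \<in> V \<Longrightarrow> levi_civita H P v X = 0"
    and \<phi>: "\<And>u. u \<in> U \<Longrightarrow> \<phi> differentiable (at u)"
      "\<And>u X. u \<in> U \<Longrightarrow> (\<lambda>v. frechet_derivative \<phi> (at v) X) differentiable (at u)"
    and tension: "\<And>u. u \<in> U \<Longrightarrow> tension G H F u = \<phi> u *\<^sub>R P (F u)"
    and u: "u \<in> U"
  shows "bitension G H F u = metric_trace (G u) (\<lambda>X Y.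
      frechet_derivative (\<lambda>v. frechet_derivative \<phi> (at v) Y) (at u) X
      - frechet_derivative \<phi> (at u) (christoffel G u X Y)) *\<^sub>R P (F u)"
proof -
  have along: "(\<lambda>v. \<psi> v *\<^sub>R P (F v)) differentiable (at v)"
    "pullback_cov H F (\<lambda>v. \<psi> v *\<^sub>R P (F v)) v X = frechet_derivative \<psi> (at v) X *\<^sub>R P (F v)"
    if "v \<in> U" "\<psi> differentiable (at v)" for \<psi> v X
    using pullback_cov_parallel[OF that P[OF F_in[OF that(1)]]] by auto
  have 1: "pullback_cov H F (tension G H F) v X = frechet_derivative \<phi> (at v) X *\<^sub>R P (F v)" if v: "v \<in> U" for v X
  proof -
    have "pullback_cov H F (tension G H F) v X = pullback_cov H F (\<lambda>v. \<phi> v *\<^sub>R P (F v)) v X"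
      by (rule pullback_cov_cong[OF dom.open_V v along(1)[OF v \<phi>(1)[OF v]] tension])
    then show ?thesis by (simp add: along(2)[OF v \<phi>(1)[OF v]])
  qed
  have 2: "pullback_cov H F (\<lambda>v. pullback_cov H F (tension G H F) v Y) u X
      = frechet_derivative (\<lambda>v. frechet_derivative \<phi> (at v) Y) (at u) X *\<^sub>R P (F u)" for X Y
  proof -
    have "pullback_cov H F (\<lambda>v. pullback_cov H F (tension G H F) v Y) u X
        = pullback_cov H F (\<lambda>v. frechet_derivative \<phi> (at v) Y *\<^sub>R P (F v)) u X"
      by (rule pullback_cov_cong[OF dom.open_V u along(1)[OF u \<phi>(2)[OF u]] 1])
    then show ?thesis by (simp add: along(2)[OF u \<phi>(2)[OF u]])
  qed
  \<comment> \<open>Only the value of the section at \<open>u\<close> enters, so the coefficient may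
    be frozen there to obtain a parallel field.\<close>
  have "riemann_curvature H (F u) X (\<phi> u *\<^sub>R P (F u)) Y = 0" for X Y
    by (rule cod.curvature_parallel[of "\<lambda>v. \<phi> u *\<^sub>R P v", OF _ _ F_in[OF u]])
       (auto simp: cod.levi_civita_scaleR P intro!: differentiable_scaleR)
  then show ?thesis
    by (simp add: bitension_def rough_laplacian_def 1[OF u] 2 levi_civita_const tension[OF u] metric_trace_zero
        metric_trace_scaleR_left flip: scaleR_diff_left)
qed

text \<open>The coefficient is \<open>k * exp (2 * r v)\<close> with \<open>k = 2 - m\<close>. The
  trace of its Hessian has a part \<open>2 * k * k\<close> from the tension field and a part
  \<open>4 * k\<close> from the square of \<open>dr\<close>; together they give
  \<open>2 * k * (2 + k)\<close>, and \<open>2 + k = 4 - m\<close>.\<close>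

lemma bitension_parallel_gradient:
  assumes \<xi>: "\<And>v. v \<in> V \<Longrightarrow> \<xi> differentiable (at v)" "\<And>v X. v \<in> V \<Longrightarrow> levi_civita H \<xi> v X = 0"
    and u: "u \<in> U"
  shows "bitension G H F u =
    (2 * (2 - real CARD('m)) * (4 - real CARD('m)) * (exp (2 * r u))\<^sup>2 * (\<xi> (F u) \<bullet> (H (F u) *v \<xi> (F u)))) *\<^sub>R \<xi> (F u)"
proof -
  define k where "k = 2 - real CARD('m)"
  define \<phi> where "\<phi> = (\<lambda>v. k * exp (2 * r v))"
  have \<phi>1: "(\<phi> has_derivative (\<lambda>X. 2 * k * exp (2 * r v) * dr v X)) (at v)" if "v \<in> U" for v
    unfolding \<phi>_def using r_diff[OF that, unfolded frechet_derivative_works]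
    by (auto intro!: derivative_eq_intros)
  \<comment> \<open>Since \<xi> is parallel along \<open>F\<close>, differentiating
    \<open>dr v Y\<close>, written as the pairing of \<xi> with \<open>DF v Y\<close>, affects only
    \<open>DF v Y\<close>.\<close>
  have r2: "((\<lambda>v. dr v Y) has_derivative
      (\<lambda>X. \<xi> (F v) \<bullet> (H (F v) *v pullback_cov H F (\<lambda>v. DF v Y) v X))) (at v)" if v: "v \<in> U" for v Y
  proof -
    have d: "(\<lambda>v. \<xi> (F v)) differentiable (at v)"
      using pullback_cov_parallel(1)[OF v, of "\<lambda>_. 1"] \<xi> F_in[OF v] by simp
    have "pullback_cov H F (\<lambda>v. \<xi> (F v)) v X = 0" for X
      using pullback_cov_parallel(2)[OF v, of "\<lambda>_. 1"] \<xi> F_in[OF v] by simp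
    with cod.metric_compatible_pullback[OF F_in[OF v] F_diff[OF v] d F_diff2[OF v, of Y]]
    have "((\<lambda>v. \<xi> (F v) \<bullet> (H (F v) *v DF v Y)) has_derivative
        (\<lambda>X. \<xi> (F v) \<bullet> (H (F v) *v pullback_cov H F (\<lambda>v. DF v Y) v X))) (at v)"
      by simp
    then show ?thesis
      by (rule has_derivative_transform_within_open[OF _ dom.open_V v]) (rule xi)
  qed
  have \<phi>2: "((\<lambda>v. frechet_derivative \<phi> (at v) Y) has_derivative
      (\<lambda>X. 2 * k * exp (2 * r v) * (\<xi> (F v) \<bullet> (H (F v) *v pullback_cov H F (\<lambda>v. DF v Y) v X))
         + 4 * k * exp (2 * r v) * (dr v X * dr v Y))) (at v)" if v: "v \<in> U" for v Y
  proof (rule has_derivative_transform_within_open[OF _ dom.open_V v])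
    show "((\<lambda>v. 2 * k * exp (2 * r v) * dr v Y) has_derivative
      (\<lambda>X. 2 * k * exp (2 * r v) * (\<xi> (F v) \<bullet> (H (F v) *v pullback_cov H F (\<lambda>v. DF v Y) v X))
         + 4 * k * exp (2 * r v) * (dr v X * dr v Y))) (at v)"
      using r_diff[OF v, unfolded frechet_derivative_works] r2[OF v]
      by (auto intro!: derivative_eq_intros simp: algebra_simps)
  qed (simp add: frechet_derivative_eqI[OF \<phi>1])
  note P = dom.sym[OF u] dom.invertible[OF u]
  \<comment> \<open>The \<open>G\<close>-Hessian of \<open>r\<close> is \<xi> paired with the second
    fundamental form; the last term comes from differentiating the exponential twice.\<close>
  have Hess: "frechet_derivative (\<lambda>v. frechet_derivative \<phi> (at v) Y) (at u) X
      - frechet_derivative \<phi> (at u) (christoffel G u X Y)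
    = 2 * k * exp (2 * r u) * (\<xi> (F u) \<bullet> (H (F u) *v second_fundamental_form G H F u X Y))
      + 4 * k * exp (2 * r u) * (dr u X *\<^sub>R dr u Y)" for X Y
    by (simp add: frechet_derivative_eqI[OF \<phi>1[OF u]] frechet_derivative_eqI[OF \<phi>2[OF u]]
        second_fundamental_form_eq matrix_vector_mult_diff_distrib inner_diff_right xi[OF u, symmetric] algebra_simps)
  have lin: "linear (\<lambda>W. \<xi> (F u) \<bullet> (H (F u) *v W))"
    by (rule linearI) (simp_all add: matrix_vector_right_distrib inner_add_right matrix_vector_mult_scaleR)
  \<comment> \<open>\<open>xi\<close> is used in both directions: the outer \<open>dr u\<close>
    becomes a pairing with \<xi>, while the inner one must be folded back for
    \<open>DF_gradient\<close> to match.\<close>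
  have grad: "dr u (matrix_inv (G u) *v (\<chi> i. dr u (axis i 1))) = exp (2 * r u) * (\<xi> (F u) \<bullet> (H (F u) *v \<xi> (F u)))"
    by (simp add: xi[OF u, symmetric] DF_gradient[OF u] matrix_vector_mult_scaleR)
       (simp add: xi[OF u] DF_gradient[OF u] matrix_vector_mult_scaleR)
  have "bitension G H F u = metric_trace (G u) (\<lambda>X Y.
      frechet_derivative (\<lambda>v. frechet_derivative \<phi> (at v) Y) (at u) X
      - frechet_derivative \<phi> (at u) (christoffel G u X Y)) *\<^sub>R \<xi> (F u)"
  proof (rule bitension_parallel[OF \<xi> _ _ _ u])
    show "\<phi> differentiable (at v)" "(\<lambda>v. frechet_derivative \<phi> (at v) X) differentiable (at v)" if "v \<in> U" for v X
      using \<phi>1[OF that] \<phi>2[OF that] unfolding differentiable_def by blast+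
    show "tension G H F v = \<phi> v *\<^sub>R \<xi> (F v)" if "v \<in> U" for v
      by (simp add: tension_conformal[OF that] \<phi>_def k_def)
  qed
  also have "metric_trace (G u) (\<lambda>X Y.
      frechet_derivative (\<lambda>v. frechet_derivative \<phi> (at v) Y) (at u) X
      - frechet_derivative \<phi> (at u) (christoffel G u X Y))
    = 2 * k * exp (2 * r u) * (\<xi> (F u) \<bullet> (H (F u) *v tension G H F u))
      + 4 * k * exp (2 * r u) * dr u (matrix_inv (G u) *v (\<chi> i. dr u (axis i 1)))"
    unfolding Hess metric_trace_add metric_trace_mult_left metric_trace_linear[OF lin]
      metric_trace_rank_one(1)[OF P linear_dr[OF u]] tension_def ..
  also have "\<dots> = 2 * k * (2 + k) * (exp (2 * r u))\<^sup>2 * (\<xi> (F u) \<bullet> (H (F u) *v \<xi> (F u)))"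
    unfolding grad tension_conformal[OF u] k_def[symmetric]
    by (simp add: matrix_vector_mult_scaleR power2_eq_square algebra_simps)
  finally show ?thesis by (simp add: k_def)
qed

end

section \<open>Conformal identity maps of manifolds\<close>

lemma smooth_on_differentiable:
  "smooth_on f S \<Longrightarrow> u \<in> S \<Longrightarrow> f differentiable (at u)"
  unfolding smooth_on_def by (drule spec[of _ "Suc 0"]) simp

lemma smooth_on_frechet_derivative:
  "smooth_on f S \<Longrightarrow> smooth_on (\<lambda>v. frechet_derivative f (at v) X) S"
  unfolding smooth_on_def by (metis Ck_on.simps(2))

lemma is_chartD:
  assumes "is_chart c"
  shows "open (chart_dom c)" "open (chart_image c)"
    "u \<in> chart_image c \<Longrightarrow> chart_inv c u \<in> chart_dom c"
    "u \<in> chart_image c \<Longrightarrow> chart_map c (chart_inv c u) = u"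
    "p \<in> chart_dom c \<Longrightarrow> chart_inv c (chart_map c p) = p"
    "p \<in> chart_dom c \<Longrightarrow> chart_map c p \<in> chart_image c"
    "continuous_on (chart_image c) (chart_inv c)"
    "continuous_on (chart_dom c) (chart_map c)"
  using assms unfolding is_chart_def homeomorphism_def by auto

lemma coord_dom_id:
  assumes "is_chart c"
  shows "coord_dom c d id = chart_image c \<inter> chart_inv c -` chart_dom d"
  using is_chartD[OF assms] unfolding coord_dom_def by force

lemma open_coord_dom_id:
  assumes "is_chart c" "is_chart d"
  shows "open (coord_dom c d id)"
  unfolding coord_dom_id[OF assms(1)]
  using is_chartD[OF assms(1)] is_chartD(1)[OF assms(2)] by (intro continuous_open_preimage)

lemma chart_inv_coord_expr_id:
  assumes "is_chart c" "is_chart d" "u \<in> coord_dom c d id"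
  shows "chart_inv d (coord_expr c d id u) = chart_inv c u"
  using assms(3) is_chartD(5)[OF assms(2)] by (simp add: coord_dom_id[OF assms(1)] coord_expr_def)

text \<open>A vanishing derivative makes \<open>f\<close> constant on coordinate balls, which are
  convex; connectedness of the manifold passes from local to global constancy.\<close>

lemma frechet_derivative_zero_imp_constant:
  fixes A :: "('a::{t2_space, second_countable_topology}, 'm::finite) chart set"
  assumes M: "smooth_manifold A" and f: "smooth_fun A f"
    and zero: "\<And>c u X. c \<in> A \<Longrightarrow> u \<in> chart_image c \<Longrightarrow> frechet_derivative (f \<circ> chart_inv c) (at u) X = 0"
  shows "f constant_on UNIV"
proof (rule locally_constant_imp_constant)
  show "connected (UNIV :: 'a set)" using M by (simp add: smooth_manifold_def)
  fix p :: 'a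
  have "p \<in> (\<Union>c\<in>A. chart_dom c)" using M by (simp add: smooth_manifold_def)
  then obtain c where c: "c \<in> A" "p \<in> chart_dom c" by blast
  then have chart: "is_chart c" using M by (simp add: smooth_manifold_def)
  note ch = is_chartD[OF chart]
  obtain e where e: "e > 0" "ball (chart_map c p) e \<subseteq> chart_image c"
    using ch(2) ch(6)[OF c(2)] open_contains_ball by blast
  define T where "T = chart_dom c \<inter> chart_map c -` ball (chart_map c p) e"
  have "open T" unfolding T_def using ch by (intro continuous_open_preimage) auto
  then have "openin (top_of_set UNIV) T" by simp
  moreover have "p \<in> T" using c e by (simp add: T_def)
  moreover have "f q = f p" if q: "q \<in> T" for q
  proof -
    have "\<exists>k. \<forall>x\<in>ball (chart_map c p) e. (f \<circ> chart_inv c) x = k"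
    proof (rule has_derivative_zero_constant)
      fix x assume x: "x \<in> ball (chart_map c p) e"
      then have xc: "x \<in> chart_image c" using e by auto
      have "smooth_on (f \<circ> chart_inv c) (chart_image c)" using f c by (simp add: smooth_fun_def)
      from smooth_on_differentiable[OF this xc] zero[OF c(1) xc]
      have "((f \<circ> chart_inv c) has_derivative (\<lambda>X. 0)) (at x)"
        unfolding frechet_derivative_works by (metis (no_types, lifting) ext)
      then show "((f \<circ> chart_inv c) has_derivative (\<lambda>X. 0)) (at x within ball (chart_map c p) e)"
        by (rule has_derivative_at_withinI)
    qed simp
    moreover have "chart_map c p \<in> ball (chart_map c p) e" "chart_map c q \<in> ball (chart_map c p) e"
      using q e by (auto simp: T_def)
    ultimately have "(f \<circ> chart_inv c) (chart_map c q) = (f \<circ> chart_inv c) (chart_map c p)" by metis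
    then show ?thesis using q c ch by (simp add: T_def)
  qed
  ultimately show "\<exists>T. openin (top_of_set UNIV) T \<and> p \<in> T \<and> (\<forall>x\<in>T. f x = f p)" by blast
qed

context metric_patch
begin

lemma gradient_inner:
  assumes "v \<in> V" "f differentiable (at v)"
  shows "gradient H f v \<bullet> (H v *v Z) = frechet_derivative f (at v) Z"
  unfolding gradient_def inner_matrix_inv[OF assms(1)]
  by (rule linear_inner_coordinates) (rule linear_frechet_derivative[OF assms(2)])

lemma differentiable_gradient:
  assumes "v \<in> V" "smooth_on f V"
  shows "gradient H f differentiable (at v)"
proof -
  have "(\<lambda>v. \<chi> i. frechet_derivative f (at v) (axis i 1)) differentiable (at v)"
    using smooth_on_differentiable[OF smooth_on_frechet_derivative[OF assms(2)] assms(1)]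
    by (simp add: differentiable_vec_iff)
  from differentiable_matrix_inv_mult[OF open_V assms(1) invertible diff[OF assms(1)] this]
  show ?thesis by (simp add: gradient_def[abs_def])
qed

end

section \<open>Instances of the coordinate locales on a manifold\<close>

lemma metric_patch_chart:
  assumes "riemannian_metric A g" "is_chart c" "c \<in> A"
    and U: "open U" "U \<subseteq> chart_image c"
  shows "metric_patch U (g c)"
  using assms by unfold_locales
    (auto simp: riemannian_metric_def intro: smooth_on_differentiable)

lemma metric_patch_C2_conformal:
  assumes g: "riemannian_metric A g" and c: "is_chart c" "c \<in> A" and \<rho>: "smooth_fun A \<rho>"
  shows "metric_patch_C2 (chart_image c) (conformal_metric \<rho> g c)"
proof -
  interpret metric_patch "chart_image c" "g c"
    by (rule metric_patch_chart[OF g c]) (use is_chartD[OF c(1)] in auto)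
  define r where "r = \<rho> \<circ> chart_inv c"
  have h: "conformal_metric \<rho> g c = (\<lambda>v. exp (2 * r v) *\<^sub>R g c v)"
    by (simp add: conformal_metric_def r_def)
  have r: "smooth_on r (chart_image c)" using \<rho> c by (simp add: smooth_fun_def r_def)
  have g': "smooth_on (g c) (chart_image c)" using g c by (simp add: riemannian_metric_def)
  have r1: "(r has_derivative frechet_derivative r (at v)) (at v)" if "v \<in> chart_image c" for v
    using smooth_on_differentiable[OF r that] by (simp add: frechet_derivative_works)
  have r2: "((\<lambda>v. frechet_derivative r (at v) X) has_derivative
      frechet_derivative (\<lambda>v. frechet_derivative r (at v) X) (at v)) (at v)" if "v \<in> chart_image c" for v X
    using smooth_on_differentiable[OF smooth_on_frechet_derivative[OF r] that] by (simp add: frechet_derivative_works)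
  have g2: "((\<lambda>v. frechet_derivative (g c) (at v) X) has_derivative
      frechet_derivative (\<lambda>v. frechet_derivative (g c) (at v) X) (at v)) (at v)" if "v \<in> chart_image c" for v X
    using smooth_on_differentiable[OF smooth_on_frechet_derivative[OF g'] that] by (simp add: frechet_derivative_works)
  have e1: "((\<lambda>v. exp (2 * r v)) has_derivative (\<lambda>X. exp (2 * r v) * (2 * frechet_derivative r (at v) X))) (at v)"
    if "v \<in> chart_image c" for v
    using r1[OF that] by (auto intro!: derivative_eq_intros)
  have h1: "((\<lambda>v. exp (2 * r v) *\<^sub>R g c v) has_derivative
      (\<lambda>X. exp (2 * r v) *\<^sub>R frechet_derivative (g c) (at v) X
         + (exp (2 * r v) * (2 * frechet_derivative r (at v) X)) *\<^sub>R g c v)) (at v)"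
    if "v \<in> chart_image c" for v
    by (rule has_derivative_scaleR[OF e1[OF that] has_derivative[OF that]])
  show ?thesis
    unfolding h
  proof
    fix v X assume v: "v \<in> chart_image c"
    show "transpose (exp (2 * r v) *\<^sub>R g c v) = exp (2 * r v) *\<^sub>R g c v"
      using sym[OF v] by (simp add: transpose_scalar)
    show "X \<bullet> ((exp (2 * r v) *\<^sub>R g c v) *v X) > 0" if "X \<noteq> 0"
      using pos[OF v that] by (simp flip: scaleR_matrix_vector_assoc)
    show "(\<lambda>v. exp (2 * r v) *\<^sub>R g c v) differentiable (at v)"
      using h1[OF v] unfolding differentiable_def by blast
    have "((\<lambda>v. exp (2 * r v) *\<^sub>R frechet_derivative (g c) (at v) X
         + (exp (2 * r v) * (2 * frechet_derivative r (at v) X)) *\<^sub>R g c v) has_derivative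
        (\<lambda>Y. exp (2 * r v) *\<^sub>R frechet_derivative (\<lambda>v. frechet_derivative (g c) (at v) X) (at v) Y
         + (exp (2 * r v) * (2 * frechet_derivative r (at v) Y)) *\<^sub>R frechet_derivative (g c) (at v) X
         + ((exp (2 * r v) * (2 * frechet_derivative r (at v) X)) *\<^sub>R frechet_derivative (g c) (at v) Y
         + (exp (2 * r v) * (2 * frechet_derivative (\<lambda>v. frechet_derivative r (at v) X) (at v) Y)
            + exp (2 * r v) * (2 * frechet_derivative r (at v) Y) * (2 * frechet_derivative r (at v) X)) *\<^sub>R g c v))) (at v)"
      by (intro has_derivative_add has_derivative_scaleR has_derivative_mult has_derivative_mult_right
          e1[OF v] g2[OF v] r2[OF v] has_derivative[OF v])
    from has_derivative_transform_within_open[OF this open_V v frechet_derivative_eqI[OF h1, THEN fun_cong, symmetric]]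
    show "(\<lambda>v. frechet_derivative (\<lambda>v. exp (2 * r v) *\<^sub>R g c v) (at v) X) differentiable (at v)"
      unfolding differentiable_def by blast
  qed (rule open_V)
qed

text \<open>Conformality is the tensor law of \<open>g\<close> multiplied by the exponential factor,
  which has the same value in both charts because the transition map represents the
  identity.\<close>

lemma conformal_patch_charts:
  assumes M: "smooth_manifold A" and g: "riemannian_metric A g" and \<rho>: "smooth_fun A \<rho>"
    and c: "c \<in> A" and d: "d \<in> A"
  shows "conformal_patch (coord_dom c d id) (g c) (chart_image d) (conformal_metric \<rho> g d)
    (coord_expr c d id) (\<rho> \<circ> chart_inv c) (gradient (conformal_metric \<rho> g d) (\<rho> \<circ> chart_inv d))"
proof -
  have chart: "is_chart c" "is_chart d" using M c d by (auto simp: smooth_manifold_def)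
  note U = coord_dom_id[OF chart(1), of d]
  note cc = is_chartD[OF chart(1)] and dd = is_chartD[OF chart(2)]
  interpret dom: metric_patch "coord_dom c d id" "g c"
    by (rule metric_patch_chart[OF g chart(1) c open_coord_dom_id[OF chart]]) (simp add: U)
  interpret cod: metric_patch_C2 "chart_image d" "conformal_metric \<rho> g d"
    by (rule metric_patch_C2_conformal[OF g chart(2) d \<rho>])
  have F: "smooth_on (coord_expr c d id) (coord_dom c d id)"
    using M c d by (simp add: smooth_manifold_def)
  have r: "smooth_on (\<rho> \<circ> chart_inv c) (chart_image c)" "smooth_on (\<rho> \<circ> chart_inv d) (chart_image d)"
    using \<rho> c d by (auto simp: smooth_fun_def)
  have F_in: "coord_expr c d id u \<in> chart_image d" if "u \<in> coord_dom c d id" for u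
    using that dd(6) by (auto simp: U coord_expr_def)
  note inv = chart_inv_coord_expr_id[OF chart]
  show ?thesis
  proof
    fix u X Y assume u: "u \<in> coord_dom c d id"
    show "coord_expr c d id u \<in> chart_image d" by (rule F_in[OF u])
    show Fd: "coord_expr c d id differentiable (at u)" by (rule smooth_on_differentiable[OF F u])
    show "(\<lambda>v. frechet_derivative (coord_expr c d id) (at v) X) differentiable (at u)"
      by (rule smooth_on_differentiable[OF smooth_on_frechet_derivative[OF F] u])
    have uc: "u \<in> chart_image c" using u by (simp add: U)
    show rd: "(\<rho> \<circ> chart_inv c) differentiable (at u)"
      by (rule smooth_on_differentiable[OF r(1) uc])
    show "exp (2 * (\<rho> \<circ> chart_inv c) u) * (X \<bullet> (g c u *v Y)) =
      frechet_derivative (coord_expr c d id) (at u) X \<bullet>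
        (conformal_metric \<rho> g d (coord_expr c d id u) *v frechet_derivative (coord_expr c d id) (at u) Y)"
      using g c d u
      by (simp add: riemannian_metric_def conformal_metric_def inv flip: scaleR_matrix_vector_assoc)
    have rd': "(\<rho> \<circ> chart_inv d) differentiable (at (coord_expr c d id u))"
      by (rule smooth_on_differentiable[OF r(2) F_in[OF u]])
    \<comment> \<open>On the overlap this composite is \<rho> read in \<open>c\<close>, so the chain
      rule relates the two differentials of \<rho>.\<close>
    have "((\<rho> \<circ> chart_inv d \<circ> coord_expr c d id) has_derivative
        (frechet_derivative (\<rho> \<circ> chart_inv d) (at (coord_expr c d id u)) \<circ> frechet_derivative (coord_expr c d id) (at u))) (at u)"
      using Fd rd' unfolding frechet_derivative_works by (rule diff_chain_at)
    then have "((\<rho> \<circ> chart_inv c) has_derivative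
        (frechet_derivative (\<rho> \<circ> chart_inv d) (at (coord_expr c d id u)) \<circ> frechet_derivative (coord_expr c d id) (at u))) (at u)"
      by (rule has_derivative_transform_within_open[OF _ dom.open_V u]) (simp add: inv)
    then show "gradient (conformal_metric \<rho> g d) (\<rho> \<circ> chart_inv d) (coord_expr c d id u) \<bullet>
        (conformal_metric \<rho> g d (coord_expr c d id u) *v frechet_derivative (coord_expr c d id) (at u) X) =
        frechet_derivative (\<rho> \<circ> chart_inv c) (at u) X"
      by (simp add: cod.gradient_inner[OF F_in[OF u] rd'] frechet_derivative_eqI)
  qed
qed

lemma smooth_map_id:
  "smooth_manifold A \<Longrightarrow> smooth_map A A id"
  by (simp add: smooth_manifold_def smooth_map_def continuous_on_id')

theorem proposition2p12:
  fixes A :: "('a::{t2_space, second_countable_topology}, 'm::finite) chart set"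
    and g :: "('a, 'm) metric"
    and \<rho> :: "'a \<Rightarrow> real"
  assumes "smooth_manifold A"
    and "riemannian_metric A g"
    and "CARD('m) \<noteq> 2"
    and "smooth_fun A \<rho>"
  shows "(\<forall>f. affine_fun A (conformal_metric \<rho> g) f \<and> \<not> f constant_on UNIV \<and> (\<forall>p. f p > 0) \<and>
              (\<forall>p. \<rho> p = ln (sqrt (f p))) \<longrightarrow>
            proper_biharmonic_map A g A (conformal_metric \<rho> g) id) \<and>
         (affine_fun A (conformal_metric \<rho> g) \<rho> \<and> \<not> \<rho> constant_on UNIV \<longrightarrow>
            (proper_biharmonic_map A g A (conformal_metric \<rho> g) id \<longleftrightarrow> CARD('m) = 4))"
proof -
  define h where "h = conformal_metric \<rho> g"
  define \<xi> where "\<xi> d = gradient (h d) (\<rho> \<circ> chart_inv d)" for d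
  note patch = conformal_patch_charts[OF assms(1,2,4), folded h_def, folded \<xi>_def]
  have C2: "metric_patch_C2 (chart_image d) (h d)" if "d \<in> A" for d
    using metric_patch_C2_conformal[OF assms(2) _ that assms(4)] that assms(1)
    by (simp add: smooth_manifold_def h_def)
  have dom: "coord_dom c c id = chart_image c" for c :: "('a, 'm) chart"
    by (auto simp: coord_dom_def chart_image_def)
  \<comment> \<open>For deductions from vanishing it suffices to use each chart \<open>c\<close> as
    both source and target chart; the domain \<open>coord_dom c c id\<close> is then the whole chart
    image.\<close>
  have const: "\<rho> constant_on UNIV"
    if "\<And>c u. c \<in> A \<Longrightarrow> u \<in> chart_image c \<Longrightarrow> \<xi> c (coord_expr c c id u) = 0"
  proof (rule frechet_derivative_zero_imp_constant[OF assms(1,4)])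
    fix c u X assume c: "c \<in> A" and u: "u \<in> chart_image c"
    interpret conformal_patch "coord_dom c c id" "g c" "chart_image c" "h c" "coord_expr c c id"
      "\<rho> \<circ> chart_inv c" "\<xi> c" by (rule patch[OF c c])
    show "frechet_derivative (\<rho> \<circ> chart_inv c) (at u) X = 0"
      using xi[of u X] u that[OF c u] by (simp add: dom)
  qed
  have not_harmonic: "\<not> harmonic_map A g A h id" if nc: "\<not> \<rho> constant_on UNIV"
  proof
    assume harm: "harmonic_map A g A h id"
    have "\<xi> c (coord_expr c c id u) = 0" if c: "c \<in> A" and u: "u \<in> chart_image c" for c u
    proof -
      interpret conformal_patch "coord_dom c c id" "g c" "chart_image c" "h c" "coord_expr c c id"
        "\<rho> \<circ> chart_inv c" "\<xi> c" by (rule patch[OF c c])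
      have "tension (g c) (h c) (coord_expr c c id) u = 0"
        using harm c u by (simp add: harmonic_map_def dom)
      then show ?thesis using tension_conformal[of u] u assms(3) by (simp add: dom)
    qed
    with const nc show False by blast
  qed
  have a: "proper_biharmonic_map A g A h id"
    if f: "affine_fun A h f" "\<not> f constant_on UNIV" "\<forall>p. f p > 0" "\<forall>p. \<rho> p = ln (sqrt (f p))" for f
  proof -
    \<comment> \<open>Positivity of \<open>f\<close> is what allows the logarithm and the square
      root to be undone.\<close>
    have f_eq: "f p = exp (2 * \<rho> p)" for p
    proof -
      have "exp (2 * \<rho> p) = (exp (\<rho> p))\<^sup>2" by (rule exp_double)
      then show ?thesis using f(3,4) by (simp add: less_imp_le)
    qed
    have "\<not> \<rho> constant_on UNIV"
      using f(2) unfolding constant_on_def f_eq by metis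
    moreover have "bitension (g c) (h d) (coord_expr c d id) u = 0"
      if c: "c \<in> A" and d: "d \<in> A" and u: "u \<in> coord_dom c d id" for c d u
    proof -
      interpret conformal_patch "coord_dom c d id" "g c" "chart_image d" "h d" "coord_expr c d id"
        "\<rho> \<circ> chart_inv c" "\<xi> d" by (rule patch[OF c d])
      define P where "P = gradient (h d) (f \<circ> chart_inv d)"
      have fs: "smooth_on (f \<circ> chart_inv d) (chart_image d)" and rs: "smooth_on (\<rho> \<circ> chart_inv d) (chart_image d)"
        using f(1) d assms(4) by (auto simp: affine_fun_def smooth_fun_def)
      have P1: "P differentiable (at v)" if "v \<in> chart_image d" for v
        unfolding P_def using that fs by (rule cod.differentiable_gradient)
      have P2: "levi_civita (h d) P v X = 0" if "v \<in> chart_image d" for v X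
        using f(1) d that by (simp add: affine_fun_def P_def)
      \<comment> \<open>The chain rule for \<open>f = exp (2 * \<rho>)\<close>, tested against every
        \<open>Z\<close>.\<close>
      have grad: "P v = (2 * exp (2 * \<rho> (chart_inv d v))) *\<^sub>R \<xi> d v" if v: "v \<in> chart_image d" for v
      proof (rule cod.nondegenerate[OF v])
        fix Z
        define s where "s = \<rho> \<circ> chart_inv d"
        have fr: "f \<circ> chart_inv d = (\<lambda>v. exp (2 * s v))" by (auto simp: f_eq s_def)
        have s: "s differentiable (at v)" unfolding s_def by (rule smooth_on_differentiable[OF rs v])
        then have "((\<lambda>v. exp (2 * s v)) has_derivative (\<lambda>X. exp (2 * s v) * (2 * frechet_derivative s (at v) X))) (at v)"
          unfolding frechet_derivative_works by (auto intro!: derivative_eq_intros)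
        then have "frechet_derivative (f \<circ> chart_inv d) (at v) Z = 2 * exp (2 * s v) * frechet_derivative s (at v) Z"
          unfolding fr by (simp add: frechet_derivative_eqI)
        then have "P v \<bullet> (h d v *v Z) = 2 * exp (2 * s v) * frechet_derivative s (at v) Z"
          unfolding P_def cod.gradient_inner[OF v smooth_on_differentiable[OF fs v]] .
        moreover have "\<xi> d v \<bullet> (h d v *v Z) = frechet_derivative s (at v) Z"
          unfolding \<xi>_def s_def[symmetric] by (rule cod.gradient_inner[OF v s])
        ultimately show "P v \<bullet> (h d v *v Z) = (2 * exp (2 * \<rho> (chart_inv d v))) *\<^sub>R \<xi> d v \<bullet> (h d v *v Z)"
          by (simp add: s_def)
      qed
      \<comment> \<open>The exponential factors of the tension field and of \<open>P\<close> agree,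
        so the coefficient of the parallel field \<open>P\<close> is constant and its Hessian
        vanishes.\<close>
      have tau: "tension (g c) (h d) (coord_expr c d id) v = ((2 - real CARD('m)) / 2) *\<^sub>R P (coord_expr c d id v)"
        if v: "v \<in> coord_dom c d id" for v
      proof -
        have "is_chart c" "is_chart d" using assms(1) c d by (simp_all add: smooth_manifold_def)
        then have "chart_inv d (coord_expr c d id v) = chart_inv c v"
          using v by (rule chart_inv_coord_expr_id)
        then show ?thesis by (simp add: tension_conformal[OF v] grad[OF F_in[OF v]])
      qed
      show ?thesis
        using bitension_parallel[OF P1 P2 _ _ tau u] by (simp add: metric_trace_zero)
    qed
    ultimately show ?thesis
      using not_harmonic smooth_map_id[OF assms(1)]
      by (simp add: proper_biharmonic_map_def biharmonic_map_def)
  qed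
  have b: "proper_biharmonic_map A g A h id \<longleftrightarrow> CARD('m) = 4"
    if \<rho>: "affine_fun A h \<rho>" "\<not> \<rho> constant_on UNIV"
  proof -
    have bit: "bitension (g c) (h d) (coord_expr c d id) u =
      (2 * (2 - real CARD('m)) * (4 - real CARD('m)) * (exp (2 * (\<rho> \<circ> chart_inv c) u))\<^sup>2 *
        (\<xi> d (coord_expr c d id u) \<bullet> (h d (coord_expr c d id u) *v \<xi> d (coord_expr c d id u))))
      *\<^sub>R \<xi> d (coord_expr c d id u)"
      if c: "c \<in> A" and d: "d \<in> A" and u: "u \<in> coord_dom c d id" for c d u
    proof -
      interpret conformal_patch "coord_dom c d id" "g c" "chart_image d" "h d" "coord_expr c d id"
        "\<rho> \<circ> chart_inv c" "\<xi> d" by (rule patch[OF c d])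
      have rs: "smooth_on (\<rho> \<circ> chart_inv d) (chart_image d)"
        using d assms(4) by (auto simp: smooth_fun_def)
      show ?thesis
      proof (rule bitension_parallel_gradient[OF _ _ u])
        fix v X assume v: "v \<in> chart_image d"
        show "\<xi> d differentiable (at v)"
          unfolding \<xi>_def using v rs by (rule cod.differentiable_gradient)
        show "levi_civita (h d) (\<xi> d) v X = 0"
          using \<rho>(1) d v by (simp add: affine_fun_def \<xi>_def)
      qed
    qed
    show ?thesis
    proof
      assume bih: "proper_biharmonic_map A g A h id"
      show "CARD('m) = 4"
      proof (rule ccontr)
        assume m: "CARD('m) \<noteq> 4"
        \<comment> \<open>If \<xi> were nonzero here, its squared norm would be positive; with
          \<open>CARD('m)\<close> neither 2 nor 4, every factor in \<open>bit\<close> would be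
          nonzero.\<close>
        have "\<xi> c (coord_expr c c id u) = 0" if c: "c \<in> A" and u: "u \<in> chart_image c" for c u
        proof (rule ccontr)
          interpret conformal_patch "coord_dom c c id" "g c" "chart_image c" "h c" "coord_expr c c id"
            "\<rho> \<circ> chart_inv c" "\<xi> c" by (rule patch[OF c c])
          assume nz: "\<xi> c (coord_expr c c id u) \<noteq> 0"
          have "bitension (g c) (h c) (coord_expr c c id) u = 0"
            using bih c u by (simp add: proper_biharmonic_map_def biharmonic_map_def dom)
          then show False
            using bit[OF c c, of u] u m assms(3) nz cod.pos[OF F_in nz, of u] by (simp add: dom)
        qed
        with const \<rho>(2) show False by blast
      qed
    next
      assume "CARD('m) = 4"
      then show "proper_biharmonic_map A g A h id"
        using bit not_harmonic[OF \<rho>(2)] smooth_map_id[OF assms(1)]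
        by (simp add: proper_biharmonic_map_def biharmonic_map_def)
    qed
  qed
  show ?thesis using a b unfolding h_def by blast
qed

end
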